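(* In three dimensions, let the neighborhood $\mathcal N$ have size $k$. Let $$\phi(u)=\sum_{m=1}^{k-1} r^k_m\,\bigl(\rho^0_m(u)-\rho^1_m(u)\bigr),$$ where $r^k_m=\frac mk\log\frac km$ in the case $q<1$ and $r^k_m=-\frac mk\log\frac km$ in the case $q>1$. Then there are a constant $c_k>0$ and a polynomial $f_k$ that is positive on $[0,1]$ with $f_k(0)=f_k(1)=1$ such that the limiting ODE $\frac{du}{dt}=\phi(u)$ is $$\frac{du}{dt}=\pm\, c_k\,u(1-u)(1-2u)f_k(u),$$ with sign $+$ for $q<1$ and sign $-$ for $q>1$; that is, $\phi(u)=\pm c_k u(1-u)(1-2u)f_k(u)$ for all $u\in[0,1]$.
   Context: Neighborhood: $\mathcal N\subset\mathbb{Z}^3$ is a fixed finite set with $0\notin\mathcal N$, $|\mathcal N|=k\ge 3$, such that the group generated by $\mathcal N$ is $\mathbb{Z}^3$. The neighbors of $x$ are the points of $x+\mathcal N$. The voter model on $\mathbb{Z}^3$ with neighborhood $\mathcal N$ is the process on $\{0,1\}^{\mathbb{Z}^3}$ in which each site $x$ flips to the opposite opinion at rate equal to the fraction $f_x$ of its $k$ neighbors having the opposite opinion. For $u\in[0,1]$, $\nu_u$ is its stationary distribution obtained as the weak limit as $t\to\infty$ of the voter model started from product measure in which each site is 1 with probability $u$. For $i\in\{0,1\}$, $\rho^i_m(u)$ is the probability under $\nu_u$ that the origin is in state $i$ and exactly $m$ of its $k$ neighbors are in state $1-i$. In the $q$-voter model each site $x$ flips at rate $f_x^q$. Writing $q=1-\epsilon$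 (case $q<1$) or $q=1+\epsilon$ (case $q>1$) and expanding $f_x^q$ to first order in $\epsilon$ around $f_x$ with $f_x=m/k$ gives the perturbation coefficient $r^k_m$ above; $\frac{du}{dt}=\phi(u)$ is the ODE limit for the density of 1's. The constant $c_k$ and the polynomial $f_k$ depend only on the neighborhood. *)

theory Defs
  imports "HOL-Probability.Probability" "HOL-Computational_Algebra.Polynomial"
    "HOL-Computational_Algebra.Group_Closure"
begin

text \<open>
  Opinions are booleans, with \<open>True\<close> for opinion 1. Configurations carry the product topology
  (compact and metrizable, since the index type is countable) and its Borel sigma-algebra.
\<close>

type_synonym site = "int ^ 3"
type_synonym config = "site \<Rightarrow> bool"

section \<open>Feller processes\<close>

text \<open>
  \<open>P t x\<close> is the law at time \<open>t\<close> of the process started from \<open>x\<close>. The state space is meant to be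
  compact, so that every continuous real function on it is bounded.
\<close>

definition feller_semigroup :: "(real \<Rightarrow> 'a::topological_space \<Rightarrow> 'a measure) \<Rightarrow> bool" where
  "feller_semigroup P \<longleftrightarrow>
     (\<forall>t\<ge>0. P t \<in> borel \<rightarrow>\<^sub>M prob_algebra borel) \<and>
     (\<forall>x. P 0 x = return borel x) \<and>
     (\<forall>s\<ge>0. \<forall>t\<ge>0. \<forall>x. P (s + t) x = P s x \<bind> P t) \<and>
     (\<forall>f :: 'a \<Rightarrow> real. continuous_on UNIV f \<longrightarrow>
        (\<forall>t\<ge>0. continuous_on UNIV (\<lambda>x. \<integral>y. f y \<partial>P t x)) \<and>
        uniform_limit UNIV (\<lambda>t x. \<integral>y. f y \<partial>P t x) f (at_right 0))"

definition generator_maps ::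
  "(real \<Rightarrow> 'a::topological_space \<Rightarrow> 'a measure) \<Rightarrow> ('a \<Rightarrow> real) \<Rightarrow> ('a \<Rightarrow> real) \<Rightarrow> bool" where
  "generator_maps P f g \<longleftrightarrow>
     continuous_on UNIV f \<and> continuous_on UNIV g \<and>
     uniform_limit UNIV (\<lambda>t x. ((\<integral>y. f y \<partial>P t x) - f x) / t) g (at_right 0)"

definition weakly_converges ::
  "('i \<Rightarrow> 'a::topological_space measure) \<Rightarrow> 'a measure \<Rightarrow> 'i filter \<Rightarrow> bool" where
  "weakly_converges \<mu> \<nu> F \<longleftrightarrow>
     (\<forall>f :: 'a \<Rightarrow> real. continuous_on UNIV f \<and> bounded (range f) \<longrightarrow>
        ((\<lambda>i. \<integral>x. f x \<partial>\<mu> i) \<longlongrightarrow> (\<integral>x. f x \<partial>\<nu>)) F)"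

section \<open>The voter model\<close>

definition depends_only_on :: "(config \<Rightarrow> real) \<Rightarrow> site set \<Rightarrow> bool" where
  "depends_only_on f A \<longleftrightarrow> (\<forall>\<eta> \<zeta>. (\<forall>x\<in>A. \<eta> x = \<zeta> x) \<longrightarrow> f \<eta> = f \<zeta>)"

definition flip :: "site \<Rightarrow> config \<Rightarrow> config" where
  "flip x \<eta> = \<eta>(x := \<not> \<eta> x)"

definition opposite_fraction :: "site set \<Rightarrow> site \<Rightarrow> config \<Rightarrow> real" where
  "opposite_fraction N x \<eta> = real (card {y \<in> N. \<eta> (x + y) \<noteq> \<eta> x}) / real (card N)"

text \<open>
  The voter model is the Feller process whose generator acts on functions \<open>f\<close> of finitely many
  sites as the formal sum, over all sites \<open>x\<close>, of
  \<open>opposite_fraction N x \<eta> * (f (flip x \<eta>) - f \<eta>)\<close>. If \<open>f\<close> depends only on \<open>A\<close>, the terms with \<open>x\<close>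
  outside \<open>A\<close> vanish. By Liggett's theorem these functions form a core (the rates are bounded and
  of finite range), so that this condition determines the semigroup.
\<close>

definition voter_model :: "site set \<Rightarrow> (real \<Rightarrow> config \<Rightarrow> config measure) \<Rightarrow> bool" where
  "voter_model N P \<longleftrightarrow>
     feller_semigroup P \<and>
     (\<forall>A f. finite A \<and> depends_only_on f A \<longrightarrow>
        generator_maps P f (\<lambda>\<eta>. \<Sum>x\<in>A. opposite_fraction N x \<eta> * (f (flip x \<eta>) - f \<eta>)))"

definition product_measure :: "real \<Rightarrow> config measure" where
  "product_measure u = Pi\<^sub>M UNIV (\<lambda>x. measure_pmf (bernoulli_pmf u))"

definition voter_equilibrium :: "site set \<Rightarrow> real \<Rightarrow> config measure \<Rightarrow> bool" where
  "voter_equilibrium N u \<nu> \<longleftrightarrow>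
     prob_space \<nu> \<and> sets \<nu> = sets borel \<and>
     (\<exists>P. voter_model N P \<and> weakly_converges (\<lambda>t. product_measure u \<bind> P t) \<nu> at_top)"

section \<open>The reaction function\<close>

definition disagreement_prob :: "site set \<Rightarrow> config measure \<Rightarrow> bool \<Rightarrow> nat \<Rightarrow> real" where
  "disagreement_prob N \<nu> i m = measure \<nu> {\<eta>. \<eta> 0 = i \<and> card {y \<in> N. \<eta> y = (\<not> i)} = m}"

definition reaction :: "(nat \<Rightarrow> nat \<Rightarrow> real) \<Rightarrow> site set \<Rightarrow> config measure \<Rightarrow> real" where
  "reaction r N \<nu> =
     (\<Sum>m = 1..card N - 1.
        r (card N) m * (disagreement_prob N \<nu> False m - disagreement_prob N \<nu> True m))"

text \<open>
  First-order coefficients in \<open>\<epsilon>\<close> of \<open>(m / k) powr q\<close>, for \<open>q = 1 - \<epsilon>\<close> and \<open>q = 1 + \<epsilon>\<close>.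
\<close>

definition coeff_q_less_1 :: "nat \<Rightarrow> nat \<Rightarrow> real" where
  "coeff_q_less_1 k m = real m / real k * ln (real k / real m)"

definition coeff_q_greater_1 :: "nat \<Rightarrow> nat \<Rightarrow> real" where
  "coeff_q_greater_1 k m = - (real m / real k * ln (real k / real m))"

end

theory Submission
  imports Defs
begin

text \<open>
  The voter model is dual to coalescing random walks: tracing back in time where the opinions at
  finitely many sites come from, the lines of descent are rate one random walks with steps in
  \<open>N\<close> which move together once they have met. Under \<open>\<nu>\<close> the opinions at the origin and at
  its neighbors are therefore obtained by letting \<open>card N + 1\<close> walkers coalesce for a long time and
  giving each resulting block of walkers an independent opinion, which is 1 with probability
  \<open>u\<close>. The reaction function thus is a mixture, with weights that depend on \<open>N\<close> only, of
  polynomials attached to the possible families of blocks (\<open>reaction_voter_equilibrium\<close>).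

  \<^bold>\<open>One family of blocks.\<close> Let \<open>B\<close> be the set of the blocks other than the one of the origin. Write
  the size \<open>s\<close> of the disagreeing part as a sum over its blocks and condition on one of them
  disagreeing; since \<open>coeff_q_less_1 k s\<close> is \<open>s / k\<close> times \<open>ln (k / s)\<close>, this size biasing turns the
  contribution of \<open>B\<close> into \<open>u (1 - u) (H u - H (1 - u))\<close>, where \<open>H\<close> is a combination of
  means of \<open>ln (k / s)\<close> (\<open>integral_observable\<close>). The logarithm decreases in \<open>s\<close>, so \<open>H\<close> is
  decreasing, and strictly so as soon as there are two blocks (\<open>block_poly_decreasing\<close>). Hence
  \<open>H u - H (1 - u)\<close> is \<open>1 - 2 u\<close> times a polynomial that is nonnegative on the unit interval,
  positive if \<open>B\<close> has two elements, and symmetric about \<open>1 / 2\<close>; the symmetry makes its values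
  at 0 and 1 equal (\<open>reflection_quotient_ge\<close>, \<open>reflection_quotient_endpoints\<close>).

  \<^bold>\<open>Positivity of the mixture.\<close> It remains to see that families with two or more blocks keep a
  positive weight, that is, that the origin and two of its neighbors may never meet (\<open>survival\<close>).
  This is where three dimensions enter: for the quadratic form \<open>q\<close> that inverts the second
  moments of \<open>N\<close>, the function \<open>1 / sqrt (100 + q x)\<close> is superharmonic for the difference of two
  walkers (\<open>transience\<close>). The sum of its three values on the pairs of walkers dominates the chance
  of a meeting and is small when the walkers are far apart, which they reach by moving along
  non-parallel directions.

  \<^bold>\<open>Duality.\<close> The voter model is given through its generator only, so duality has to be derived from
  it (\<open>voter_duality\<close>): the expectations of all functions \<open>F (\<eta> \<circ> z)\<close> satisfy the linear system of
  differential equations of the coalescing walks, and as the coefficients are bounded, Taylor's formula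
  identifies them with the power series of the dual semigroup. The weights are bounded, so they
  converge along a sequence of times; that is enough, because the expectation under the voter model
  converges along all times.
\<close>

section \<open>Laws evolving under a Feller semigroup\<close>

definition law_at :: "'a measure \<Rightarrow> (real \<Rightarrow> 'a \<Rightarrow> 'a measure) \<Rightarrow> real \<Rightarrow> 'a measure" where
  "law_at \<mu> P t = \<mu> \<bind> P t"

lemma feller_kernel:
  assumes "feller_semigroup P" "t \<ge> 0"
  shows "P t \<in> borel \<rightarrow>\<^sub>M prob_algebra borel" "P t \<in> borel \<rightarrow>\<^sub>M subprob_algebra borel"
  using assms measurable_prob_algebraD unfolding feller_semigroup_def by blast+

lemma law_at_prob:
  assumes "feller_semigroup P" "t \<ge> 0" "\<mu> \<in> space (prob_algebra borel)"
  shows "prob_space (law_at \<mu> P t)" "sets (law_at \<mu> P t) = sets borel"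
proof -
  have "law_at \<mu> P t \<in> space (prob_algebra borel)"
    unfolding law_at_def
    using measurable_bind_prob_space[of "\<lambda>_. \<mu>" "count_space UNIV" borel "P t" borel] feller_kernel[OF assms(1,2)] assms(3)
    by (auto dest: measurable_space)
  then show "prob_space (law_at \<mu> P t)" "sets (law_at \<mu> P t) = sets borel"
    by (auto simp: space_prob_algebra)
qed

lemma law_at_in_prob_algebra:
  assumes "feller_semigroup P" "t \<ge> 0" "\<mu> \<in> space (prob_algebra borel)"
  shows "law_at \<mu> P t \<in> space (prob_algebra borel)"
  using law_at_prob[OF assms] by (simp add: space_prob_algebra)

lemma law_at_zero:
  assumes "feller_semigroup P" "\<mu> \<in> space (prob_algebra borel)"
  shows "law_at \<mu> P 0 = \<mu>"
proof -
  have "P 0 = return borel" using assms(1) by (auto simp: feller_semigroup_def)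
  then show ?thesis using assms(2) by (simp add: law_at_def space_prob_algebra bind_return'')
qed

lemma law_at_add:
  assumes "feller_semigroup P" "\<mu> \<in> space (prob_algebra borel)" "s \<ge> 0" "t \<ge> 0"
  shows "law_at \<mu> P (s + t) = law_at (law_at \<mu> P s) P t"
proof -
  have [measurable_cong]: "sets \<mu> = sets borel" using assms by (simp add: space_prob_algebra)
  have "P s \<in> \<mu> \<rightarrow>\<^sub>M subprob_algebra borel"
    using feller_kernel(2)[OF assms(1,3)] by simp
  moreover have "P (s + t) = (\<lambda>x. P s x \<bind> P t)"
    using assms by (auto simp: feller_semigroup_def)
  ultimately show ?thesis
    unfolding law_at_def using bind_assoc[OF _ feller_kernel(2)[OF assms(1,4)], of "P s" \<mu>] by simp
qed

lemma integral_law_at: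
  fixes f :: "'a::topological_space \<Rightarrow> real"
  assumes "feller_semigroup P" "\<mu> \<in> space (prob_algebra borel)" "t \<ge> 0"
    and "f \<in> borel_measurable borel" "\<And>x. \<bar>f x\<bar> \<le> C"
  shows "(\<integral>x. f x \<partial>law_at \<mu> P t) = (\<integral>x. (\<integral>y. f y \<partial>P t x) \<partial>\<mu>)"
proof -
  interpret prob_space \<mu> using assms by (simp add: space_prob_algebra)
  have s [measurable_cong]: "sets \<mu> = sets borel" using assms by (simp add: space_prob_algebra)
  note k = feller_kernel[OF assms(1,3)]
  have "prob_space (P t x)" for x
    using measurable_space[OF k(1), of x] by (simp add: space_prob_algebra)
  then have "emeasure (P t x) (space (P t x)) \<le> ennreal 1" for x
    by (simp add: prob_space.emeasure_space_1)
  then show ?thesis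
    unfolding law_at_def
    by (intro integral_bind[where K=borel and B=C and B'=1])
       (use assms k(2) finite_measure_axioms in auto)
qed

lemma integral_kernel_measurable:
  fixes f :: "'a::topological_space \<Rightarrow> real"
  assumes "feller_semigroup P" "t \<ge> 0" "continuous_on UNIV f"
  shows "(\<lambda>x. \<integral>y. f y \<partial>P t x) \<in> borel_measurable borel"
  using assms by (intro borel_measurable_continuous_onI) (auto simp: feller_semigroup_def)

lemma prob_integral_abs_le:
  fixes f :: "'a::topological_space \<Rightarrow> real"
  assumes "\<mu> \<in> space (prob_algebra borel)" "f \<in> borel_measurable borel" "\<And>x. \<bar>f x\<bar> \<le> C"
  shows "\<bar>\<integral>x. f x \<partial>\<mu>\<bar> \<le> C" "integrable \<mu> f"
proof -
  interpret prob_space \<mu> using assms by (simp add: space_prob_algebra)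
  have [measurable_cong]: "sets \<mu> = sets borel" using assms by (simp add: space_prob_algebra)
  show i: "integrable \<mu> f"
    by (rule integrable_const_bound[of _ C]) (use assms in auto)
  have "\<bar>\<integral>y. f y \<partial>\<mu>\<bar> \<le> (\<integral>y. \<bar>f y\<bar> \<partial>\<mu>)" by (rule integral_abs_bound)
  also have "\<dots> \<le> C"
    by (rule integral_le_const) (use i assms in auto)
  finally show "\<bar>\<integral>x. f x \<partial>\<mu>\<bar> \<le> C" .
qed

lemma integral_kernel_bound:
  fixes f :: "'a::topological_space \<Rightarrow> real"
  assumes "feller_semigroup P" "t \<ge> 0" "f \<in> borel_measurable borel" "\<And>x. \<bar>f x\<bar> \<le> C"
  shows "\<bar>\<integral>y. f y \<partial>P t x\<bar> \<le> C"
  by (rule prob_integral_abs_le(1)[OF _ assms(3,4)])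
     (use measurable_space[OF feller_kernel(1)[OF assms(1,2)], of x] in simp)

text \<open>
  The generator describes the semigroup near time 0 only. Since the convergence is uniform in the starting
  point, it can be integrated against the law at time \<open>s\<close>, which gives the right derivative at \<open>s\<close>.
  For the left derivative the law at the earlier time has to be used, and the strong continuity of the
  semigroup on \<open>g\<close> moves it back to \<open>t\<close>.
\<close>

lemma kolmogorov_forward:
  fixes f g :: "'a::topological_space \<Rightarrow> real"
  assumes P: "feller_semigroup P" and \<mu>: "\<mu> \<in> space (prob_algebra borel)"
    and gen: "generator_maps P f g"
    and f: "\<And>x. \<bar>f x\<bar> \<le> C" and g: "\<And>x. \<bar>g x\<bar> \<le> D" and t: "t \<ge> 0"
  shows "((\<lambda>t. \<integral>x. f x \<partial>law_at \<mu> P t) has_field_derivative (\<integral>x. g x \<partial>law_at \<mu> P t)) (at t within {0..})"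
proof -
  define V where "V = (\<lambda>t. \<integral>x. f x \<partial>law_at \<mu> P t)"
  define W where "W = (\<lambda>t. \<integral>x. g x \<partial>law_at \<mu> P t)"
  have cf: "continuous_on UNIV f" and cg: "continuous_on UNIV g"
    using gen by (auto simp: generator_maps_def)
  have mf: "f \<in> borel_measurable borel" and mg: "g \<in> borel_measurable borel"
    using cf cg by (auto intro: borel_measurable_continuous_onI)
  \<comment> \<open>The forward difference quotient at \<open>s\<close> is an integral of the one at time 0.\<close>
  have step: "\<bar>V (s + h) - V s - h * W s\<bar> \<le> h * e"
    if "s \<ge> 0" "h > 0" and e: "\<And>x. \<bar>((\<integral>y. f y \<partial>P h x) - f x) / h - g x\<bar> \<le> e" for s h e
  proof -
    let ?m = "law_at \<mu> P s" and ?F = "\<lambda>x. \<integral>y. f y \<partial>P h x"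
    have m: "?m \<in> space (prob_algebra borel)" using law_at_in_prob_algebra[OF P _ \<mu>] that by simp
    have F: "?F \<in> borel_measurable borel" using integral_kernel_measurable[OF P _ cf] that by simp
    have i: "integrable ?m ?F" "integrable ?m f" "integrable ?m g"
      using prob_integral_abs_le(2)[OF m F integral_kernel_bound[OF P _ mf f]]
        prob_integral_abs_le(2)[OF m mf f] prob_integral_abs_le(2)[OF m mg g] that by auto
    have "V (s + h) = (\<integral>x. ?F x \<partial>?m)"
      unfolding V_def using that integral_law_at[OF P m _ mf f, of h] by (simp add: law_at_add[OF P \<mu>])
    then have "V (s + h) - V s - h * W s = h * (\<integral>x. (?F x - f x) / h - g x \<partial>?m)"
      unfolding V_def W_def using i that by (simp add: field_simps)
    moreover have "\<bar>\<integral>x. (?F x - f x) / h - g x \<partial>?m\<bar> \<le> e"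
      by (rule prob_integral_abs_le(1)[OF m _ e]) (use F mf mg in measurable)
    ultimately show ?thesis using that by (simp add: abs_mult)
  qed
  \<comment> \<open>Strong continuity at time 0, integrated against the law at time \<open>s\<close>.\<close>
  have cont: "\<bar>W (s + h) - W s\<bar> \<le> e"
    if "s \<ge> 0" "h \<ge> 0" and e: "\<And>x. \<bar>(\<integral>y. g y \<partial>P h x) - g x\<bar> \<le> e" for s h e
  proof -
    let ?m = "law_at \<mu> P s" and ?F = "\<lambda>x. \<integral>y. g y \<partial>P h x"
    have m: "?m \<in> space (prob_algebra borel)" using law_at_in_prob_algebra[OF P _ \<mu>] that by simp
    have F: "?F \<in> borel_measurable borel" using integral_kernel_measurable[OF P _ cg] that by simp
    have i: "integrable ?m ?F" "integrable ?m g"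
      using prob_integral_abs_le(2)[OF m F integral_kernel_bound[OF P _ mg g]]
        prob_integral_abs_le(2)[OF m mg g] that by auto
    have "W (s + h) = (\<integral>x. ?F x \<partial>?m)"
      unfolding W_def using that integral_law_at[OF P m _ mg g, of h] by (simp add: law_at_add[OF P \<mu>])
    then have "W (s + h) - W s = (\<integral>x. ?F x - g x \<partial>?m)"
      unfolding W_def using i by simp
    also have "\<bar>\<dots>\<bar> \<le> e"
      by (rule prob_integral_abs_le(1)[OF m _ e]) (use F mg in measurable)
    finally show ?thesis .
  qed
  have "((\<lambda>s. (V s - V t) / (s - t)) \<longlongrightarrow> W t) (at t within {0..})"
    unfolding Lim_within
  proof (intro allI impI)
    fix e :: real assume "e > 0"
    then have e: "e / 3 > 0" by simp
    have "\<forall>\<^sub>F h in at_right 0. \<forall>x\<in>UNIV. dist (((\<integral>y. f y \<partial>P h x) - f x) / h) (g x) < e / 3"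
      using gen unfolding generator_maps_def by (intro uniform_limitD[OF _ e]) simp
    moreover have "\<forall>\<^sub>F h in at_right 0. \<forall>x\<in>UNIV. dist (\<integral>y. g y \<partial>P h x) (g x) < e / 3"
      using P cg unfolding feller_semigroup_def by (intro uniform_limitD[OF _ e]) simp
    ultimately have "\<forall>\<^sub>F h in at_right 0. (\<forall>x. \<bar>((\<integral>y. f y \<partial>P h x) - f x) / h - g x\<bar> \<le> e / 3) \<and>
        (\<forall>x. \<bar>(\<integral>y. g y \<partial>P h x) - g x\<bar> \<le> e / 3)"
      by eventually_elim (auto simp: dist_real_def intro: less_imp_le)
    then obtain d where d: "d > 0" and
      df: "\<And>h x. 0 < h \<Longrightarrow> h < d \<Longrightarrow> \<bar>((\<integral>y. f y \<partial>P h x) - f x) / h - g x\<bar> \<le> e / 3" and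
      dg: "\<And>h x. 0 < h \<Longrightarrow> h < d \<Longrightarrow> \<bar>(\<integral>y. g y \<partial>P h x) - g x\<bar> \<le> e / 3"
      unfolding eventually_at_right_field by blast
    have "dist ((V s - V t) / (s - t)) (W t) < e" if s: "s \<in> {0..}" "0 < dist s t" "dist s t < d" for s
    proof (cases "s > t")
      case True
      have "\<bar>V (t + (s - t)) - V t - (s - t) * W t\<bar> \<le> (s - t) * (e / 3)"
        by (rule step) (use s True t df[of "s - t"] in \<open>auto simp: dist_real_def\<close>)
      then have "\<bar>(V s - V t) / (s - t) - W t\<bar> \<le> e / 3"
        using True by (simp add: field_simps abs_le_iff)
      then show ?thesis using e by (simp add: dist_real_def)
    next
      case False
      then have h: "t - s > 0" using s by (auto simp: dist_real_def)
      have 1: "\<bar>V (s + (t - s)) - V s - (t - s) * W s\<bar> \<le> (t - s) * (e / 3)"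
        by (rule step) (use s h df[of "t - s"] in \<open>auto simp: dist_real_def\<close>)
      have 2: "\<bar>W t - W s\<bar> \<le> e / 3"
        using cont[of s "t - s" "e / 3"] s h dg[of "t - s"] by (auto simp: dist_real_def)
      have "(V s - V t) / (s - t) = (V t - V s) / (t - s)" by (metis minus_diff_eq minus_divide_divide)
      moreover have "\<bar>(V t - V s) / (t - s) - W s\<bar> \<le> e / 3"
        using 1 h by (simp add: field_simps abs_le_iff)
      ultimately have "\<bar>(V s - V t) / (s - t) - W t\<bar> \<le> e / 3 + e / 3" using 2 by linarith
      then show ?thesis using e by (simp add: dist_real_def)
    qed
    then show "\<exists>d>0. \<forall>s\<in>{0..}. 0 < dist s t \<and> dist s t < d \<longrightarrow> dist ((V s - V t) / (s - t)) (W t) < e"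
      using d by blast
  qed
  then show ?thesis unfolding has_field_derivative_iff V_def W_def .
qed

section \<open>Coalescing random walks\<close>

definition jump :: "(site \<Rightarrow> site) \<Rightarrow> site \<Rightarrow> site \<Rightarrow> site \<Rightarrow> site" where
  "jump z x y = (\<lambda>i. if z i = x then x + y else z i)"

locale neighborhood =
  fixes N :: "site set"
  assumes finite_N: "finite N" and zero_notin: "0 \<notin> N" and card_N: "card N \<ge> 3"
    and generating: "group_closure N = UNIV"
begin

text \<open>
  One walker starts from each point of \<open>I\<close>, and the walkers are named after their starting points.
  A state of the coalescing walks is the map \<open>z\<close> from names to positions.
\<close>

abbreviation I :: "site set" where "I \<equiv> insert 0 N"

text \<open>
  There are at most \<open>card I\<close> occupied sites, each of which jumps at rate 1, so that the walks can be
  driven by a single Poisson clock of this rate.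
\<close>

definition clock_rate :: real where "clock_rate = real (card I)"

lemma card_N_pos: "real (card N) > 0" using card_N by simp

lemma clock_rate_pos: "clock_rate > 0" using finite_N by (simp add: clock_rate_def card_gt_0_iff)

text \<open>
  The transition operator of the coalescing walks at a tick of the clock: each occupied site moves with
  probability \<open>1 / clock_rate\<close>, and nothing happens with the remaining probability. All walkers on a site
  move together.
\<close>

definition dual_step :: "((site \<Rightarrow> site) \<Rightarrow> real) \<Rightarrow> (site \<Rightarrow> site) \<Rightarrow> real" where
  "dual_step \<phi> z = (1 - real (card (z ` I)) / clock_rate) * \<phi> z
     + (\<Sum>x\<in>z ` I. \<Sum>y\<in>N. \<phi> (jump z x y)) / (clock_rate * real (card N))"

lemma stay_prob_nonneg: "1 - real (card (z ` I)) / clock_rate \<ge> 0"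
  using clock_rate_pos card_image_le[of I z] finite_N by (simp add: clock_rate_def)

lemma dual_step_mono:
  assumes "\<And>z. \<phi> z \<le> \<psi> z"
  shows "dual_step \<phi> z \<le> dual_step \<psi> z"
  unfolding dual_step_def using assms clock_rate_pos card_N_pos stay_prob_nonneg
  by (intro add_mono mult_left_mono divide_right_mono sum_mono) auto

lemma dual_step_const: "dual_step (\<lambda>_. c) z = c"
  unfolding dual_step_def using clock_rate_pos card_N_pos
  by (simp add: field_simps)

lemma dual_step_sum:
  "dual_step (\<lambda>z. \<Sum>b\<in>S. c b * \<phi> b z) z = (\<Sum>b\<in>S. c b * dual_step (\<phi> b) z)"
proof -
  have "(\<Sum>x\<in>z ` I. \<Sum>y\<in>N. \<Sum>b\<in>S. c b * \<phi> b (jump z x y))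
      = (\<Sum>b\<in>S. c b * (\<Sum>x\<in>z ` I. \<Sum>y\<in>N. \<phi> b (jump z x y)))"
    unfolding sum_distrib_left by (subst sum.swap, subst (2) sum.swap) (rule refl)
  then show ?thesis
    unfolding dual_step_def
    by (simp add: sum_distrib_left sum_distrib_right sum_divide_distrib sum.distrib distrib_left mult_ac)
qed

lemma dual_step_generator:
  "clock_rate * (dual_step \<phi> z - \<phi> z)
    = (\<Sum>x\<in>z ` I. (\<Sum>y\<in>N. \<phi> (jump z x y) - \<phi> z) / real (card N))"
  unfolding dual_step_def using clock_rate_pos card_N_pos
  by (simp add: sum_subtractf sum_divide_distrib[symmetric] field_simps)

lemma dual_step_linear:
  "dual_step (\<lambda>z. a * (\<phi> z - \<psi> z)) z = a * (dual_step \<phi> z - dual_step \<psi> z)"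
  unfolding dual_step_def
  by (simp add: sum_subtractf sum_distrib_left[symmetric] algebra_simps diff_divide_distrib)

lemma dual_steps_mono:
  assumes "\<And>z. \<phi> z \<le> \<psi> z"
  shows "(dual_step ^^ n) \<phi> z \<le> (dual_step ^^ n) \<psi> z"
  using assms by (induction n arbitrary: z) (auto intro: dual_step_mono)

lemma dual_steps_const: "(dual_step ^^ n) (\<lambda>_. c) z = c"
proof -
  have "(dual_step ^^ n) (\<lambda>_. c) = (\<lambda>_. c)"
    by (induction n) (auto simp: dual_step_const)
  then show ?thesis by simp
qed

lemma dual_steps_sum:
  "(dual_step ^^ n) (\<lambda>z. \<Sum>b\<in>S. c b * \<phi> b z) z = (\<Sum>b\<in>S. c b * (dual_step ^^ n) (\<phi> b) z)"
proof -
  have "(dual_step ^^ n) (\<lambda>z. \<Sum>b\<in>S. c b * \<phi> b z) = (\<lambda>z. \<Sum>b\<in>S. c b * (dual_step ^^ n) (\<phi> b) z)"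
    by (induction n) (auto simp: dual_step_sum)
  then show ?thesis by simp
qed

lemma dual_steps_bound:
  assumes "\<And>z. \<bar>\<phi> z\<bar> \<le> C"
  shows "\<bar>(dual_step ^^ n) \<phi> z\<bar> \<le> C"
  using dual_steps_mono[of \<phi> "\<lambda>_. C" n z] dual_steps_mono[of "\<lambda>_. - C" \<phi> n z] assms
  by (auto simp: dual_steps_const abs_le_iff) (metis abs_le_iff minus_le_iff)

text \<open>
  The number of ticks up to time \<open>t\<close> is Poisson distributed with mean \<open>clock_rate * t\<close>.
\<close>

definition dual_semigroup :: "real \<Rightarrow> ((site \<Rightarrow> site) \<Rightarrow> real) \<Rightarrow> (site \<Rightarrow> site) \<Rightarrow> real" where
  "dual_semigroup t \<phi> z
    = exp (- (clock_rate * t)) * (\<Sum>n. (clock_rate * t) ^ n / fact n * (dual_step ^^ n) \<phi> z)"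

lemma dual_semigroup_summable:
  assumes "\<And>z. \<bar>\<phi> z\<bar> \<le> C"
  shows "summable (\<lambda>n. (clock_rate * t) ^ n / fact n * (dual_step ^^ n) \<phi> z)"
proof (rule summable_comparison_test')
  show "summable (\<lambda>n. C * (\<bar>clock_rate * t\<bar> ^ n /\<^sub>R fact n))"
    by (intro summable_mult summable_exp_generic)
  show "norm ((clock_rate * t) ^ n / fact n * (dual_step ^^ n) \<phi> z) \<le> C * (\<bar>clock_rate * t\<bar> ^ n /\<^sub>R fact n)" 
    if "n \<ge> 0" for n
    using mult_left_mono[OF dual_steps_bound[of \<phi> C n z, OF assms], of "\<bar>clock_rate * t\<bar> ^ n / fact n"]
    by (simp add: abs_mult power_abs divide_inverse mult_ac)
qed

lemma dual_semigroup_sum: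
  assumes "\<And>b z. b \<in> S \<Longrightarrow> \<bar>\<phi> b z\<bar> \<le> C"
  shows "dual_semigroup t (\<lambda>z. \<Sum>b\<in>S. c b * \<phi> b z) z = (\<Sum>b\<in>S. c b * dual_semigroup t (\<phi> b) z)"
proof -
  have s: "summable (\<lambda>n. (clock_rate * t) ^ n / fact n * (dual_step ^^ n) (\<phi> b) z)" if "b \<in> S" for b
    using dual_semigroup_summable[OF assms[OF that]] .
  have "(\<Sum>n. (clock_rate * t) ^ n / fact n * (dual_step ^^ n) (\<lambda>z. \<Sum>b\<in>S. c b * \<phi> b z) z)
      = (\<Sum>n. \<Sum>b\<in>S. c b * ((clock_rate * t) ^ n / fact n * (dual_step ^^ n) (\<phi> b) z))"
    unfolding dual_steps_sum sum_distrib_left by (simp only: mult.left_commute)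
  also have "\<dots> = (\<Sum>b\<in>S. c b * (\<Sum>n. (clock_rate * t) ^ n / fact n * (dual_step ^^ n) (\<phi> b) z))"
    by (subst suminf_sum) (intro summable_mult s sum.cong refl suminf_mult; assumption)+
  finally show ?thesis
    unfolding dual_semigroup_def by (simp add: sum_distrib_left mult_ac)
qed

lemma dual_semigroup_mono:
  assumes "t \<ge> 0" "\<And>z. \<phi> z \<le> \<psi> z" "\<And>z. \<bar>\<phi> z\<bar> \<le> C" "\<And>z. \<bar>\<psi> z\<bar> \<le> C"
  shows "dual_semigroup t \<phi> z \<le> dual_semigroup t \<psi> z"
  unfolding dual_semigroup_def
  by (intro mult_left_mono suminf_le dual_semigroup_summable dual_steps_mono)
     (use assms clock_rate_pos in auto)

lemma dual_semigroup_const: "dual_semigroup t (\<lambda>_. c) z = c"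
proof -
  have "(\<lambda>n. (clock_rate * t) ^ n / fact n * c) sums (exp (clock_rate * t) * c)"
    using exp_converges[of "clock_rate * t"] by (intro sums_mult2) (simp add: field_simps)
  then show ?thesis
    by (simp add: dual_semigroup_def dual_steps_const sums_unique[symmetric] exp_minus field_simps)
qed

text \<open>
  At a large time the clock has ticked \<open>M\<close> times with high probability, so that a lower bound after
  \<open>M\<close> steps carries over up to an error that tends to 0. The error is stated with \<open>x ^ n\<close> in
  place of \<open>x ^ n / fact n\<close>.
\<close>

lemma dual_semigroup_ge:
  assumes "t \<ge> 0" "\<And>z. 0 \<le> \<phi> z" "\<And>z. \<phi> z \<le> C" "\<delta> \<ge> 0" "\<And>n. n \<ge> M \<Longrightarrow> \<delta> \<le> (dual_step ^^ n) \<phi> z"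
  shows "dual_semigroup t \<phi> z \<ge> \<delta> - \<delta> * (\<Sum>n<M. (clock_rate * t) ^ n / exp (clock_rate * t))"
proof -
  let ?x = "clock_rate * t"
  have x: "?x \<ge> 0" using assms clock_rate_pos by simp
  have "\<And>z. \<bar>\<phi> z\<bar> \<le> C" using assms by (simp add: abs_of_nonneg)
  note s = dual_semigroup_summable[OF this, where t=t and z=z]
  have nn: "(dual_step ^^ n) \<phi> z \<ge> 0" for n
    using dual_steps_mono[of "\<lambda>_. 0" \<phi> n z] assms by (simp add: dual_steps_const)
  have e: "(\<lambda>n. ?x ^ n / fact n * \<delta>) sums (exp ?x * \<delta>)"
    using exp_converges[of ?x] by (intro sums_mult2) (simp add: field_simps)
  have f: "(\<lambda>n. if n < M then ?x ^ n * \<delta> else 0) sums (\<Sum>n<M. ?x ^ n * \<delta>)"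
    using sums_If_finite_set[of "{..<M}" "\<lambda>n. ?x ^ n * \<delta>"] by simp
  have "exp ?x * \<delta> - (\<Sum>n<M. ?x ^ n * \<delta>) \<le> (\<Sum>n. ?x ^ n / fact n * (dual_step ^^ n) \<phi> z)"
  proof (rule sums_le[OF _ sums_diff[OF e f] summable_sums[OF s]])
    fix n
    show "?x ^ n / fact n * \<delta> - (if n < M then ?x ^ n * \<delta> else 0) \<le> ?x ^ n / fact n * (dual_step ^^ n) \<phi> z"
    proof (cases "n < M")
      case True
      have "?x ^ n / fact n \<le> ?x ^ n"
        using x divide_left_mono[of 1 "fact n" "?x ^ n"] by simp
      then have "?x ^ n / fact n * \<delta> \<le> ?x ^ n * \<delta>" using assms(4) by (rule mult_right_mono)
      moreover have "0 \<le> ?x ^ n / fact n * (dual_step ^^ n) \<phi> z" using x nn by simp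
      ultimately show ?thesis using True by simp
    next
      case False
      then show ?thesis using assms(5)[of n] x by (auto intro!: divide_right_mono mult_left_mono)
    qed
  qed
  then have "exp (- ?x) * (exp ?x * \<delta> - (\<Sum>n<M. ?x ^ n * \<delta>)) \<le> dual_semigroup t \<phi> z"
    unfolding dual_semigroup_def by (intro mult_left_mono) auto
  moreover have "exp (- ?x) * (exp ?x * \<delta> - (\<Sum>n<M. ?x ^ n * \<delta>)) = \<delta> - \<delta> * (\<Sum>n<M. ?x ^ n / exp ?x)"
    by (simp add: exp_minus right_diff_distrib divide_inverse sum_distrib_left mult_ac)
  ultimately show ?thesis by simp
qed

lemma dual_steps_deriv:
  assumes v: "\<And>z. ((\<lambda>t. v t z) has_field_derivative clock_rate * (dual_step (v t) z - v t z)) (at t within S)"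
  shows "((\<lambda>t. (dual_step ^^ n) (v t) z) has_field_derivative
     clock_rate * ((dual_step ^^ Suc n) (v t) z - (dual_step ^^ n) (v t) z)) (at t within S)"
proof (induction n arbitrary: z)
  case 0
  then show ?case using v by simp
next
  case (Suc n)
  define w where "w = (\<lambda>z. clock_rate * ((dual_step ^^ Suc n) (v t) z - (dual_step ^^ n) (v t) z))"
  have "((\<lambda>t. dual_step ((dual_step ^^ n) (v t)) z) has_field_derivative dual_step w z) (at t within S)"
    unfolding dual_step_def[of "(dual_step ^^ n) _"] dual_step_def[of w]
    by (intro DERIV_add DERIV_cmult DERIV_cdivide DERIV_sum) (use Suc in \<open>auto simp: w_def\<close>)
  then show ?case unfolding w_def dual_step_linear by simp
qed

text \<open>
  The factor \<open>exp (clock_rate * t)\<close> turns the generator \<open>clock_rate * (dual_step - 1)\<close> into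
  \<open>clock_rate * dual_step\<close>, so that the \<open>n\<close>-th derivative of a solution is explicit. The
  operator has norm one on bounded functions; hence the remainder in Taylor's formula is at most
  a constant times \<open>(clock_rate * T) ^ (n + 1) / fact n\<close>.
\<close>

lemma dual_semigroup_unique:
  assumes v: "\<And>t z. t \<ge> 0 \<Longrightarrow> ((\<lambda>t. v t z) has_field_derivative clock_rate * (dual_step (v t) z - v t z)) (at t within {0..})"
    and bound: "\<And>t z. t \<ge> 0 \<Longrightarrow> \<bar>v t z\<bar> \<le> C" and T: "T \<ge> 0"
  shows "v T z = dual_semigroup T (v 0) z"
proof -
  \<comment> \<open>The \<open>n\<close>-th derivative of \<open>exp (clock_rate * t) * v t z\<close>.\<close>
  define w where "w = (\<lambda>n t. exp (clock_rate * t) * (clock_rate ^ n * (dual_step ^^ n) (v t) z))"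
  have w: "(w n has_field_derivative w (Suc n) t) (at t within {0..T})" if "t \<in> {0..T}" for n t
  proof -
    have "(w n has_field_derivative w (Suc n) t) (at t within {0..})"
      unfolding w_def using that
      by (auto intro!: derivative_eq_intros dual_steps_deriv[OF v] simp: algebra_simps)
    then show ?thesis by (rule DERIV_subset) auto
  qed
  have B: "norm (w (Suc n) t) \<le> exp (clock_rate * T) * (clock_rate ^ Suc n * C)" if "t \<in> {0..T}" for n t
  proof -
    have "\<bar>(dual_step ^^ Suc n) (v t) z\<bar> \<le> C" using dual_steps_bound[of "v t" C "Suc n" z, OF bound] that by auto
    moreover have "exp (clock_rate * t) \<le> exp (clock_rate * T)" using that clock_rate_pos by simp
    ultimately show ?thesis unfolding w_def real_norm_def abs_mult
      using clock_rate_pos by (intro mult_mono) (auto simp: power_abs)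
  qed
  have est: "norm (w 0 T - (\<Sum>i\<le>n. w i 0 * (T - 0) ^ i / fact i))
      \<le> exp (clock_rate * T) * (clock_rate ^ Suc n * C) * norm (T - 0) ^ Suc n / fact n" for n
    by (rule field_Taylor[where S="{0..T}"]) (use w B T in auto)
  have "(\<lambda>n. exp (clock_rate * T) * C * (clock_rate * T) * ((clock_rate * T) ^ n /\<^sub>R fact n)) \<longlonglongrightarrow> 
      exp (clock_rate * T) * C * (clock_rate * T) * 0"
    by (intro tendsto_mult_left summable_LIMSEQ_zero summable_exp_generic)
  then have lim: "(\<lambda>n. exp (clock_rate * T) * C * (clock_rate * T) * ((clock_rate * T) ^ n /\<^sub>R fact n)) \<longlonglongrightarrow> 0"
    by simp
  have "norm (w 0 T - (\<Sum>i\<le>n. w i 0 * T ^ i / fact i))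
      \<le> exp (clock_rate * T) * C * (clock_rate * T) * ((clock_rate * T) ^ n /\<^sub>R fact n)" for n
    using est[of n] T by (simp add: power_mult_distrib divide_inverse mult_ac)
  then have "(\<lambda>n. w 0 T - (\<Sum>i\<le>n. w i 0 * T ^ i / fact i)) \<longlonglongrightarrow> 0"
    by (intro Lim_null_comparison[OF always_eventually lim]) blast
  then have "(\<lambda>n. w 0 T - (w 0 T - (\<Sum>i\<le>n. w i 0 * T ^ i / fact i))) \<longlonglongrightarrow> w 0 T - 0"
    by (intro tendsto_diff tendsto_const)
  then have "(\<lambda>i. w i 0 * T ^ i / fact i) sums w 0 T"
    by (simp add: sums_def_le)
  then have "(\<Sum>i. (clock_rate * T) ^ i / fact i * (dual_step ^^ i) (v 0) z) = exp (clock_rate * T) * v T z"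
    by (intro sums_unique[symmetric]) (simp add: w_def power_mult_distrib mult_ac)
  then show ?thesis by (simp add: dual_semigroup_def exp_minus)
qed


text \<open>
  Copying the opinion of the neighbor \<open>x + y\<close> to the site \<open>x\<close> changes what the walkers see in the same
  way as moving the walkers from \<open>x\<close> to \<open>x + y\<close> does.
\<close>

lemma voter_generator_dual:
  fixes F :: "config \<Rightarrow> real"
  shows "(\<Sum>x\<in>z ` I. opposite_fraction N x \<eta> * (F (flip x \<eta> \<circ> z) - F (\<eta> \<circ> z)))
    = clock_rate * (dual_step (\<lambda>z. F (\<eta> \<circ> z)) z - F (\<eta> \<circ> z))"
proof (rule trans[OF sum.cong[OF refl] dual_step_generator[of "\<lambda>z. F (\<eta> \<circ> z)", symmetric]])
  fix x
  have "(\<Sum>y\<in>N. F (\<eta> \<circ> jump z x y) - F (\<eta> \<circ> z))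
     = (\<Sum>y\<in>N. if \<eta> (x + y) \<noteq> \<eta> x then F (flip x \<eta> \<circ> z) - F (\<eta> \<circ> z) else 0)"
  proof (rule sum.cong[OF refl])
    fix y
    have "\<eta> \<circ> jump z x y = (if \<eta> (x + y) \<noteq> \<eta> x then flip x \<eta> \<circ> z else \<eta> \<circ> z)"
      by (auto simp: jump_def flip_def fun_eq_iff)
    then show "F (\<eta> \<circ> jump z x y) - F (\<eta> \<circ> z) = (if \<eta> (x + y) \<noteq> \<eta> x then F (flip x \<eta> \<circ> z) - F (\<eta> \<circ> z) else 0)"
      by simp
  qed
  also have "\<dots> = real (card {y \<in> N. \<eta> (x + y) \<noteq> \<eta> x}) * (F (flip x \<eta> \<circ> z) - F (\<eta> \<circ> z))"
    using finite_N by (simp add: sum.If_cases Int_def)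
  finally show "opposite_fraction N x \<eta> * (F (flip x \<eta> \<circ> z) - F (\<eta> \<circ> z))
      = (\<Sum>y\<in>N. F (\<eta> \<circ> jump z x y) - F (\<eta> \<circ> z)) / real (card N)"
    by (simp add: opposite_fraction_def)
qed

lemma voter_duality:
  fixes F :: "config \<Rightarrow> real"
  assumes P: "voter_model N P" and \<mu>: "\<mu> \<in> space (prob_algebra borel)"
    and F: "depends_only_on F I" "\<And>\<eta>. \<bar>F \<eta>\<bar> \<le> C" and t: "t \<ge> 0"
  shows "(\<integral>\<eta>. F (\<eta> \<circ> z) \<partial>law_at \<mu> P t) = dual_semigroup t (\<lambda>z. \<integral>\<eta>. F (\<eta> \<circ> z) \<partial>\<mu>) z"
proof -
  have fel: "feller_semigroup P" using P by (simp add: voter_model_def)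
  define L where "L = (\<lambda>z \<eta>. clock_rate * (dual_step (\<lambda>z. F (\<eta> \<circ> z)) z - F (\<eta> \<circ> z)))"
  have gen: "generator_maps P (\<lambda>\<eta>. F (\<eta> \<circ> z)) (L z)" for z :: "site \<Rightarrow> site"
  proof -
    have "depends_only_on (\<lambda>\<eta>. F (\<eta> \<circ> z)) (z ` I)"
      using F(1) by (auto simp: depends_only_on_def)
    moreover have "finite (z ` I)" using finite_N by simp
    ultimately have "generator_maps P (\<lambda>\<eta>. F (\<eta> \<circ> z))
        (\<lambda>\<eta>. \<Sum>x\<in>z ` I. opposite_fraction N x \<eta> * (F (flip x \<eta> \<circ> z) - F (\<eta> \<circ> z)))"
      using P unfolding voter_model_def by blast
    then show ?thesis unfolding voter_generator_dual L_def .
  qed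
  have cont: "(\<lambda>\<eta>. F (\<eta> \<circ> z)) \<in> borel_measurable borel" for z :: "site \<Rightarrow> site"
    using gen[of z] by (intro borel_measurable_continuous_onI) (simp add: generator_maps_def)
  have int: "integrable (law_at \<mu> P s) (\<lambda>\<eta>. F (\<eta> \<circ> z))" if "s \<ge> 0" for s and z :: "site \<Rightarrow> site"
    using prob_integral_abs_le(2)[OF law_at_in_prob_algebra[OF fel that \<mu>] cont F(2)] .
  have Lb: "\<bar>L z \<eta>\<bar> \<le> clock_rate * (C + C)" for z :: "site \<Rightarrow> site" and \<eta>
    unfolding L_def abs_mult using dual_steps_bound[of "\<lambda>z. F (\<eta> \<circ> z)" C 1 z, OF F(2)] F(2)[of "\<eta> \<circ> z"] clock_rate_pos
    by (auto intro!: mult_mono)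
  have "(\<lambda>z. \<integral>\<eta>. F (\<eta> \<circ> z) \<partial>law_at \<mu> P 0) = (\<lambda>z. \<integral>\<eta>. F (\<eta> \<circ> z) \<partial>\<mu>)"
    using law_at_zero[OF fel \<mu>] by simp
  moreover have "(\<integral>\<eta>. F (\<eta> \<circ> z) \<partial>law_at \<mu> P t) = dual_semigroup t (\<lambda>z. \<integral>\<eta>. F (\<eta> \<circ> z) \<partial>law_at \<mu> P 0) z"
  proof (rule dual_semigroup_unique[OF _ _ t])
    fix s :: real and z :: "site \<Rightarrow> site" assume s: "s \<ge> 0"
    show "\<bar>\<integral>\<eta>. F (\<eta> \<circ> z) \<partial>law_at \<mu> P s\<bar> \<le> C"
      by (rule prob_integral_abs_le(1)[OF law_at_in_prob_algebra[OF fel s \<mu>] cont F(2)])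
    have eq: "(\<integral>\<eta>. L z \<eta> \<partial>law_at \<mu> P s)
      = clock_rate * (dual_step (\<lambda>z. \<integral>\<eta>. F (\<eta> \<circ> z) \<partial>law_at \<mu> P s) z - (\<integral>\<eta>. F (\<eta> \<circ> z) \<partial>law_at \<mu> P s))"
      unfolding L_def dual_step_def using int[OF s] by (simp only: Bochner_Integration.integral_mult_right_zero Bochner_Integration.integral_diff
        Bochner_Integration.integral_add Bochner_Integration.integral_sum Bochner_Integration.integral_divide_zero
        Bochner_Integration.integrable_add Bochner_Integration.integrable_sum Bochner_Integration.integrable_divide_zero Bochner_Integration.integrable_mult_right)
    show "((\<lambda>s. \<integral>\<eta>. F (\<eta> \<circ> z) \<partial>law_at \<mu> P s) has_field_derivative
       clock_rate * (dual_step (\<lambda>z. \<integral>\<eta>. F (\<eta> \<circ> z) \<partial>law_at \<mu> P s) z - (\<integral>\<eta>. F (\<eta> \<circ> z) \<partial>law_at \<mu> P s)))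
       (at s within {0..})"
      by (rule DERIV_cong[OF kolmogorov_forward[OF fel \<mu> gen[of z] F(2) Lb s] eq])
  qed
  ultimately show ?thesis by simp
qed

end

section \<open>Means over random subsets\<close>

text \<open>
  The mean of \<open>f A\<close>, as a polynomial in \<open>u\<close>, for the random subset \<open>A\<close> of \<open>Y\<close> that contains
  each point independently with probability \<open>u\<close>.
\<close>

definition bernoulli_mean :: "'b set \<Rightarrow> ('b set \<Rightarrow> real) \<Rightarrow> real poly" where
  "bernoulli_mean Y f = (\<Sum>A\<in>Pow Y. smult (f A) ([:0, 1:] ^ card A * [:1, -1:] ^ card (Y - A)))"

lemma poly_bernoulli_mean:
  "poly (bernoulli_mean Y f) u = (\<Sum>A\<in>Pow Y. f A * (u ^ card A * (1 - u) ^ card (Y - A)))"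
  by (simp add: bernoulli_mean_def poly_sum)

lemma bernoulli_mean_cong:
  assumes "\<And>A. A \<subseteq> Y \<Longrightarrow> f A = g A"
  shows "bernoulli_mean Y f = bernoulli_mean Y g"
  unfolding bernoulli_mean_def using assms by (intro sum.cong) auto

lemma bernoulli_mean_insert:
  assumes "finite Y" "y \<notin> Y"
  shows "bernoulli_mean (insert y Y) f
    = [:0, 1:] * bernoulli_mean Y (\<lambda>A. f (insert y A)) + [:1, -1:] * bernoulli_mean Y f"
proof -
  let ?t = "\<lambda>A. smult (f A) ([:0, 1:] ^ card A * [:1, -1:] ^ card (insert y Y - A))"
  have "bernoulli_mean (insert y Y) f = sum ?t (Pow Y) + sum ?t (insert y ` Pow Y)"
    unfolding bernoulli_mean_def Pow_insert
    by (rule sum.union_disjoint) (use assms in auto)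
  also have "sum ?t (Pow Y) = [:1, -1:] * bernoulli_mean Y f"
    unfolding bernoulli_mean_def sum_distrib_left
  proof (intro sum.cong refl)
    fix A assume "A \<in> Pow Y"
    then have "insert y Y - A = insert y (Y - A)" "y \<notin> Y - A" "finite (Y - A)" using assms by auto
    then have "card (insert y Y - A) = Suc (card (Y - A))" by simp
    then show "?t A = [:1, -1:] * smult (f A) ([:0, 1:] ^ card A * [:1, -1:] ^ card (Y - A))"
      by (simp only: power_Suc mult_smult_right mult.left_commute)
  qed
  also have "sum ?t (insert y ` Pow Y) = sum (?t \<circ> insert y) (Pow Y)"
    by (rule sum.reindex) (use assms in \<open>auto simp: inj_on_def\<close>)
  also have "\<dots> = [:0, 1:] * bernoulli_mean Y (\<lambda>A. f (insert y A))"
    unfolding bernoulli_mean_def sum_distrib_left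
  proof (intro sum.cong refl)
    fix A assume "A \<in> Pow Y"
    then have "insert y Y - insert y A = Y - A" "y \<notin> A" "finite A"
      using assms finite_subset[of A Y] by auto
    then have "insert y Y - insert y A = Y - A" "card (insert y A) = Suc (card A)" by auto
    then show "(?t \<circ> insert y) A = [:0, 1:] * smult (f (insert y A)) ([:0, 1:] ^ card A * [:1, -1:] ^ card (Y - A))"
      by (simp only: o_def power_Suc mult_smult_right mult.assoc)
  qed
  finally show ?thesis by simp
qed

lemma bernoulli_mean_reindex:
  assumes "inj_on \<phi> Y"
  shows "bernoulli_mean (\<phi> ` Y) f = bernoulli_mean Y (\<lambda>A. f (\<phi> ` A))"
proof -
  have "Pow (\<phi> ` Y) = (`) \<phi> ` Pow Y" by (simp add: image_Pow_surj)
  moreover have "inj_on ((`) \<phi>) (Pow Y)" using assms by (rule inj_on_image_Pow)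
  moreover have "card (\<phi> ` Y - \<phi> ` A) = card (Y - A)" "card (\<phi> ` A) = card A" if "A \<in> Pow Y" for A
    using that assms inj_on_subset[OF assms]
    by (auto simp: inj_on_image_set_diff[OF assms, symmetric] intro!: card_image)
  ultimately show ?thesis
    unfolding bernoulli_mean_def by (simp add: sum.reindex)
qed

lemma poly_bernoulli_mean_reflect:
  assumes "finite Y"
  shows "poly (bernoulli_mean Y f) (1 - u) = poly (bernoulli_mean Y (\<lambda>A. f (Y - A))) u"
  unfolding poly_bernoulli_mean
  by (rule sum.reindex_bij_witness[of _ "\<lambda>A. Y - A" "\<lambda>A. Y - A"]) (auto simp: double_diff)

lemma poly_bernoulli_mean_mono:
  assumes "0 \<le> u" "u \<le> 1" "\<And>A. A \<subseteq> Y \<Longrightarrow> f A \<le> g A"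
  shows "poly (bernoulli_mean Y f) u \<le> poly (bernoulli_mean Y g) u"
  unfolding poly_bernoulli_mean using assms by (intro sum_mono mult_right_mono) auto

lemma bernoulli_mean_sum:
  "bernoulli_mean Y (\<lambda>A. \<Sum>b\<in>S. c b * g b A) = (\<Sum>b\<in>S. smult (c b) (bernoulli_mean Y (g b)))"
  by (rule poly_eqI)
     (simp add: bernoulli_mean_def coeff_sum sum_distrib_left sum_distrib_right sum.swap[of _ S] mult_ac)

lemma bernoulli_mean_add_const:
  assumes "finite Y"
  shows "poly (bernoulli_mean Y (\<lambda>A. f A + c)) u = poly (bernoulli_mean Y f) u + c"
  using assms
proof (induction Y arbitrary: f)
  case empty
  then show ?case by (simp add: poly_bernoulli_mean)
next
  case (insert y Y)
  then show ?case by (simp add: bernoulli_mean_insert algebra_simps)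
qed

text \<open>
  If adding a point lowers \<open>f\<close> by at least \<open>\<kappa>\<close>, then raising the density lowers the mean, at a rate of at
  least \<open>\<kappa>\<close> per point. The induction splits off one point \<open>y\<close>: the means over the other points decrease
  by hypothesis, and moving weight \<open>w - u\<close> from the sets without \<open>y\<close> to those with \<open>y\<close>
  costs another \<open>\<kappa>\<close>.
\<close>

lemma bernoulli_mean_decreasing:
  assumes "finite Y" and "\<And>A y. A \<subseteq> Y \<Longrightarrow> y \<in> Y - A \<Longrightarrow> f (insert y A) + \<kappa> \<le> f A"
    and "0 \<le> u" "u \<le> w" "w \<le> 1"
  shows "poly (bernoulli_mean Y f) w + \<kappa> * real (card Y) * (w - u) \<le> poly (bernoulli_mean Y f) u"
  using assms(1,2)
proof (induction Y arbitrary: f)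
  case empty
  then show ?case by (simp add: poly_bernoulli_mean)
next
  case (insert y Y)
  let ?f = "\<lambda>A. f (insert y A)" and ?E = "\<lambda>f u. poly (bernoulli_mean Y f) u"
  let ?c = "\<kappa> * real (card Y) * (w - u)"
  have 1: "?E f w + ?c \<le> ?E f u"
  proof (rule insert.IH)
    fix A z assume "A \<subseteq> Y" "z \<in> Y - A"
    then show "f (insert z A) + \<kappa> \<le> f A" using insert.prems[of A z] by auto
  qed
  have 2: "?E ?f w + ?c \<le> ?E ?f u"
  proof (rule insert.IH)
    fix A z assume "A \<subseteq> Y" "z \<in> Y - A"
    then show "f (insert y (insert z A)) + \<kappa> \<le> f (insert y A)"
      using insert.prems[of "insert y A" z] insert.hyps by (auto simp: insert_commute)
  qed
  have "?E (\<lambda>A. ?f A + \<kappa>) u \<le> ?E f u"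
  proof (rule poly_bernoulli_mean_mono)
    fix A assume "A \<subseteq> Y"
    then show "?f A + \<kappa> \<le> f A" using insert.prems[of A y] insert.hyps by auto
  qed (use assms in auto)
  then have "?E ?f u + \<kappa> \<le> ?E f u" using insert by (simp add: bernoulli_mean_add_const)
  then have "(w - u) * (?E ?f u + \<kappa>) \<le> (w - u) * ?E f u"
    using assms by (intro mult_left_mono) auto
  moreover have "w * (?E ?f w + ?c) \<le> w * ?E ?f u" "(1 - w) * (?E f w + ?c) \<le> (1 - w) * ?E f u"
    using 1 2 assms by (auto intro!: mult_left_mono)
  ultimately show ?case using insert.hyps
    by (simp add: bernoulli_mean_insert algebra_simps)
qed

text \<open>
  Exchange the two sums: a point \<open>b\<close> belongs to the random set with probability \<open>u\<close>, and the other points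
  are independent of this event.
\<close>

lemma bernoulli_mean_size_bias:
  assumes "finite Y"
  shows "bernoulli_mean Y (\<lambda>A. (\<Sum>b\<in>A. c b) * g A)
    = [:0, 1:] * (\<Sum>b\<in>Y. smult (c b) (bernoulli_mean (Y - {b}) (\<lambda>A. g (insert b A))))"
proof -
  have "bernoulli_mean Y (\<lambda>A. (\<Sum>b\<in>A. c b) * g A) = bernoulli_mean Y (\<lambda>A. \<Sum>b\<in>Y. c b * (if b \<in> A then g A else 0))"
  proof (rule bernoulli_mean_cong)
    fix A assume "A \<subseteq> Y"
    then have "(\<Sum>b\<in>A. c b * g A) = (\<Sum>b\<in>Y. if b \<in> A then c b * g A else 0)"
      using assms by (simp add: sum.inter_restrict[symmetric] Int_absorb1)
    then show "(\<Sum>b\<in>A. c b) * g A = (\<Sum>b\<in>Y. c b * (if b \<in> A then g A else 0))"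
      by (simp add: sum_distrib_right if_distrib cong: if_cong)
  qed
  also have "\<dots> = (\<Sum>b\<in>Y. smult (c b) (bernoulli_mean Y (\<lambda>A. if b \<in> A then g A else 0)))"
    by (rule bernoulli_mean_sum)
  also have "\<dots> = (\<Sum>b\<in>Y. smult (c b) ([:0, 1:] * bernoulli_mean (Y - {b}) (\<lambda>A. g (insert b A))))"
  proof (rule sum.cong[OF refl])
    fix b assume b: "b \<in> Y"
    have "bernoulli_mean (insert b (Y - {b})) (\<lambda>A. if b \<in> A then g A else 0)
      = [:0, 1:] * bernoulli_mean (Y - {b}) (\<lambda>A. g (insert b A)) + [:1, -1:] * bernoulli_mean (Y - {b}) (\<lambda>A. if b \<in> A then g A else 0)"
      using assms by (subst bernoulli_mean_insert) auto
    moreover have "bernoulli_mean (Y - {b}) (\<lambda>A. if b \<in> A then g A else 0) = bernoulli_mean (Y - {b}) (\<lambda>A. 0)"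
      by (rule bernoulli_mean_cong) auto
    moreover have "\<dots> = 0" by (simp add: bernoulli_mean_def)
    ultimately show "smult (c b) (bernoulli_mean Y (\<lambda>A. if b \<in> A then g A else 0))
      = smult (c b) ([:0, 1:] * bernoulli_mean (Y - {b}) (\<lambda>A. g (insert b A)))"
      using b by (simp add: insert_absorb)
  qed
  finally show ?thesis by (simp only: sum_distrib_left mult_smult_right)
qed

text \<open>
  The antisymmetric polynomial \<open>p u - p (1 - u)\<close> vanishes at \<open>1 / 2\<close>, so that the division is exact.
\<close>

definition reflection_quotient :: "real poly \<Rightarrow> real poly" where
  "reflection_quotient p = (p - pcompose p [:1, -1:]) div [:1, -2:]"

lemma reflection_quotient:
  fixes p :: "real poly"
  shows "(1 - 2 * u) * poly (reflection_quotient p) u = poly p u - poly p (1 - u)"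
proof -
  let ?D = "p - pcompose p [:1, -1:]"
  have "poly ?D (1 / 2) = 0" by (simp add: poly_pcompose)
  then have "[:- (1/2), 1:] dvd ?D" by (rule iffD1[OF poly_eq_0_iff_dvd])
  moreover have "[:1, -2:] = smult (-2) [:- (1/2), 1 :: real:]" by simp
  ultimately have "[:1, -2:] dvd ?D" by (metis smult_dvd_iff neg_equal_0_iff_equal zero_neq_numeral)
  then have "[:1, -2:] * reflection_quotient p = ?D"
    unfolding reflection_quotient_def by (rule dvd_mult_div_cancel)
  then have "poly ([:1, -2:] * reflection_quotient p) u = poly ?D u" by simp
  then show ?thesis by (simp add: poly_pcompose algebra_simps)
qed

lemma reflection_quotient_endpoints: "poly (reflection_quotient p) 0 = poly (reflection_quotient p) 1"
  using reflection_quotient[of 0 p] reflection_quotient[of 1 p] by simp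

text \<open>
  Away from \<open>1 / 2\<close> the quotient is the slope of the decreasing function between \<open>u\<close> and \<open>1 - u\<close>, up to
  sign; the value at \<open>1 / 2\<close> follows by continuity.
\<close>

lemma reflection_quotient_ge:
  assumes dec: "\<And>u w. 0 \<le> u \<Longrightarrow> u \<le> w \<Longrightarrow> w \<le> 1 \<Longrightarrow> poly p w + \<kappa> * (w - u) \<le> poly p u"
    and u: "u \<in> {0..1}"
  shows "\<kappa> \<le> poly (reflection_quotient p) u"
proof -
  have off: "\<kappa> \<le> poly (reflection_quotient p) u" if "u \<in> {0..1}" "u \<noteq> 1 / 2" for u
  proof (cases "u < 1 / 2")
    case True
    then have "(1 - 2 * u) * \<kappa> \<le> (1 - 2 * u) * poly (reflection_quotient p) u"
      using dec[of u "1 - u"] that unfolding reflection_quotient by (simp add: algebra_simps)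
    then show ?thesis using True by (simp add: mult_le_cancel_left)
  next
    case False
    then have "(1 - 2 * u) * poly (reflection_quotient p) u \<le> (1 - 2 * u) * \<kappa>"
      using dec[of "1 - u" u] that unfolding reflection_quotient by (simp add: algebra_simps)
    then show ?thesis using False that by (simp add: mult_le_cancel_left)
  qed
  show ?thesis
  proof (cases "u = 1 / 2")
    case True
    have "(poly (reflection_quotient p) \<longlongrightarrow> poly (reflection_quotient p) (1/2)) (at (1/2))"
      using poly_isCont[of "1/2"] by (simp add: isCont_def)
    moreover have "\<forall>\<^sub>F x in at (1/2). \<kappa> \<le> poly (reflection_quotient p) x"
      unfolding eventually_at
      by (rule exI[of _ "1/2"]) (auto simp: dist_real_def abs_if intro!: off split: if_splits)
    ultimately show ?thesis unfolding True by (intro tendsto_lowerbound) auto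
  qed (use off u in auto)
qed

text \<open>
  Summed over the blocks \<open>b\<close> with weights \<open>card b / k\<close>, the mean of \<open>ln (k / s)\<close>, where \<open>s\<close> is the
  total size of the disagreeing blocks given that \<open>b\<close> is one of them. This is what size biasing
  makes of the reaction coefficient.
\<close>

definition block_poly :: "nat \<Rightarrow> 'a set set \<Rightarrow> real poly" where
  "block_poly k B = (\<Sum>b\<in>B. smult (real (card b) / real k)
     (bernoulli_mean (B - {b}) (\<lambda>A. ln (real k / real (\<Sum>a\<in>insert b A. card a)))))"

lemma bernoulli_mean_coeff_q_less_1:
  assumes "finite B"
  shows "bernoulli_mean B (\<lambda>A. coeff_q_less_1 k (\<Sum>b\<in>A. card b)) = [:0, 1:] * block_poly k B"
proof -
  have "coeff_q_less_1 k (\<Sum>b\<in>A. card b)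
    = (\<Sum>b\<in>A. real (card b) / real k) * ln (real k / real (\<Sum>b\<in>A. card b))" for A :: "'a set set"
    by (simp add: coeff_q_less_1_def sum_divide_distrib)
  then show ?thesis
    using bernoulli_mean_size_bias[OF assms, of "\<lambda>b. real (card b) / real k" "\<lambda>A. ln (real k / real (\<Sum>b\<in>A. card b))"]
    by (simp add: block_poly_def)
qed

lemma ln_add_ge:
  fixes s c W :: real
  assumes "0 < s" "s \<le> W" "1 \<le> c"
  shows "ln s + ln (1 + 1 / W) \<le> ln (s + c)"
proof -
  have "1 + 1 / W > 0" using assms by (simp add: add_pos_pos)
  then have "ln s + ln (1 + 1 / W) = ln (s * (1 + 1 / W))" using assms by (subst ln_mult) auto
  also have "\<dots> \<le> ln (s + c)"
  proof (subst ln_le_cancel_iff)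
    have "s / W \<le> 1" using assms by simp
    then show "s * (1 + 1 / W) \<le> s + c" using \<open>1 \<le> c\<close> unfolding distrib_left by simp
  qed (use assms \<open>1 + 1 / W > 0\<close> in \<open>auto intro: mult_pos_pos\<close>)
  finally show ?thesis .
qed

text \<open>
  Adding a block increases the total size by a factor of at least \<open>1 + 1 / W\<close> if all sizes are at most \<open>W\<close>,
  and so lowers \<open>ln (k / s)\<close> by a fixed amount. A mean over the other blocks depends on the density only if
  there are any, hence the condition \<open>card B \<ge> 2\<close>.
\<close>

lemma block_poly_decreasing:
  fixes B :: "'a set set"
  assumes B: "finite B" "\<And>b. b \<in> B \<Longrightarrow> card b > 0" and k: "k > 0"
  obtains \<kappa> where "\<kappa> \<ge> 0" "card B \<ge> 2 \<Longrightarrow> \<kappa> > 0"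
    "\<And>u w. 0 \<le> u \<Longrightarrow> u \<le> w \<Longrightarrow> w \<le> 1 \<Longrightarrow> poly (block_poly k B) w + \<kappa> * (w - u) \<le> poly (block_poly k B) u"
proof -
  \<comment> \<open>The summand 1 keeps \<open>W\<close> positive when there are no blocks.\<close>
  define W where "W = real (\<Sum>b\<in>B. card b) + 1"
  define \<kappa>0 where "\<kappa>0 = ln (1 + 1 / W)"
  have W: "W > 0" unfolding W_def by (intro add_nonneg_pos of_nat_0_le_iff zero_less_one)
  then have \<kappa>0: "\<kappa>0 > 0" unfolding \<kappa>0_def by (intro ln_gt_zero) simp
  define \<kappa> where "\<kappa> = (\<Sum>b\<in>B. real (card b) / real k * (\<kappa>0 * real (card (B - {b}))))"
  show ?thesis
  proof
    show "\<kappa> \<ge> 0" unfolding \<kappa>_def using \<kappa>0 by (intro sum_nonneg) simp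
    show "\<kappa> > 0" if "card B \<ge> 2"
      unfolding \<kappa>_def
    proof (rule sum_pos)
      fix b assume b: "b \<in> B"
      then have "card (B - {b}) > 0" using that B by (simp add: card_Diff_singleton)
      then show "real (card b) / real k * (\<kappa>0 * real (card (B - {b}))) > 0"
        using B(2)[OF b] k \<kappa>0 by simp
    qed (use that B in auto)
  next
    fix u w :: real assume uw: "0 \<le> u" "u \<le> w" "w \<le> 1"
    define p where "p = (\<lambda>b. bernoulli_mean (B - {b}) (\<lambda>A. ln (real k / real (\<Sum>a\<in>insert b A. card a))))"
    have "poly (p b) w + \<kappa>0 * real (card (B - {b})) * (w - u) \<le> poly (p b) u" if b: "b \<in> B" for b
      unfolding p_def
    proof (rule bernoulli_mean_decreasing[OF _ _ uw])
      fix A y assume A: "A \<subseteq> B - {b}" "y \<in> B - {b} - A"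
      then have fin: "finite A" using B finite_subset[of A B] by auto
      define s where "s = real (\<Sum>a\<in>insert b A. card a)"
      have "(\<Sum>a\<in>insert b A. card a) \<le> (\<Sum>a\<in>B. card a)"
        by (rule sum_mono2) (use A B b in auto)
      then have "s \<le> W" unfolding W_def s_def by linarith
      have "card b > 0" "card y > 0" using B(2) b A by auto
      moreover have "card b \<le> (\<Sum>a\<in>insert b A. card a)"
        by (rule member_le_sum) (use fin in auto)
      ultimately have s: "s > 0" unfolding s_def by linarith
      have "ln s + \<kappa>0 \<le> ln (s + real (card y))"
        unfolding \<kappa>0_def by (rule ln_add_ge) (use s \<open>s \<le> W\<close> \<open>card y > 0\<close> in auto)
      moreover have "real (\<Sum>a\<in>insert b (insert y A). card a) = s + real (card y)"
        unfolding s_def insert_commute[of b y] using A fin by (subst sum.insert) auto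
      moreover have "s + real (card y) > 0" using s by linarith
      ultimately show "ln (real k / real (\<Sum>a\<in>insert b (insert y A). card a)) + \<kappa>0
          \<le> ln (real k / real (\<Sum>a\<in>insert b A. card a))"
        unfolding s_def[symmetric] using s k by (auto simp only: ln_div split: if_splits)
    qed (use B in auto)
    then have "(\<Sum>b\<in>B. real (card b) / real k * (poly (p b) w + \<kappa>0 * real (card (B - {b})) * (w - u)))
      \<le> (\<Sum>b\<in>B. real (card b) / real k * poly (p b) u)"
      by (intro sum_mono mult_left_mono) auto
    moreover have "(\<Sum>b\<in>B. real (card b) / real k * (poly (p b) w + \<kappa>0 * real (card (B - {b})) * (w - u)))
      = (\<Sum>b\<in>B. real (card b) / real k * poly (p b) w) + \<kappa> * (w - u)"
      unfolding \<kappa>_def sum_distrib_right sum.distrib[symmetric] by (simp only: distrib_left mult.assoc)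
    moreover have "poly (block_poly k B) x = (\<Sum>b\<in>B. real (card b) / real k * poly (p b) x)" for x
      unfolding block_poly_def p_def by (simp only: poly_sum poly_smult)
    ultimately show "poly (block_poly k B) w + \<kappa> * (w - u) \<le> poly (block_poly k B) u" by simp
  qed
qed

section \<open>Product measures\<close>

text \<open>
  The product sigma-algebra on configurations agrees with the Borel one because the set of sites is countable
  and the topology of opinions has a countable base.
\<close>

instance bool :: second_countable_topology
proof
  have "countable (range lessThan \<union> range greaterThan :: bool set set)" by (intro countable_finite) simp
  then show "\<exists>B::bool set set. countable B \<and> open = generate_topology B"
    using open_generated_order by blast
qed

lemma product_measure_prob: "product_measure u \<in> space (prob_algebra (borel :: config measure))"
proof -
  interpret product_prob_space "\<lambda>_::site. measure_pmf (bernoulli_pmf u)" UNIV ..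
  have "sets (product_measure u) = sets (Pi\<^sub>M UNIV (\<lambda>_::site. borel :: bool measure))"
    unfolding product_measure_def by (rule sets_PiM_cong) (auto simp: sets_borel_eq_count_space)
  also have "\<dots> = sets borel" by (rule sets_PiM_equal_borel)
  finally have "sets (product_measure u) = sets borel" .
  then show ?thesis
    using P.prob_space_axioms
    by (simp add: space_prob_algebra product_measure_def)
qed

text \<open>
  A function of finitely many sites is a finite combination of indicators of cylinder sets.
\<close>

lemma integral_product_measure:
  assumes X: "finite X" and G: "depends_only_on G X" and u: "u \<in> {0..1}"
  shows "(\<integral>\<eta>. G \<eta> \<partial>product_measure u) = poly (bernoulli_mean X (\<lambda>A. G (\<lambda>x. x \<in> A))) u"
proof -
  interpret product_prob_space "\<lambda>_::site. measure_pmf (bernoulli_pmf u)" UNIV ..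
  define cyl where "cyl = (\<lambda>A. {\<eta>::config. \<forall>x\<in>X. \<eta> x = (x \<in> A)})"
  have sp: "space (product_measure u) = UNIV"
    by (simp add: product_measure_def space_PiM)
  have cyl: "cyl A \<in> sets (product_measure u) \<and>
      measure (product_measure u) (cyl A) = u ^ card A * (1 - u) ^ card (X - A)" if A: "A \<subseteq> X" for A
  proof
    have eq: "cyl A = {\<eta>\<in>space (Pi\<^sub>M UNIV (\<lambda>_::site. measure_pmf (bernoulli_pmf u))). \<forall>x\<in>X. \<eta> x \<in> {x \<in> A}}"
      by (auto simp: cyl_def space_PiM)
    show "cyl A \<in> sets (product_measure u)"
      unfolding eq product_measure_def
      by (intro sets.sets_Collect_finite_All sets_Collect_single) (use X in auto)
    have "emeasure (product_measure u) (cyl A) = (\<Prod>x\<in>X. emeasure (measure_pmf (bernoulli_pmf u)) {x \<in> A})"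
      unfolding eq product_measure_def by (rule emeasure_PiM_Collect) (use X in auto)
    also have "\<dots> = (\<Prod>x\<in>X. ennreal (if x \<in> A then u else 1 - u))"
      using u by (intro prod.cong refl) (auto simp: emeasure_pmf_single)
    also have "\<dots> = ennreal (\<Prod>x\<in>X. if x \<in> A then u else 1 - u)"
      by (rule prod_ennreal) (use u in auto)
    also have "(\<Prod>x\<in>X. if x \<in> A then u else 1 - u) = u ^ card A * (1 - u) ^ card (X - A)"
      using X A by (subst prod.If_cases) (auto simp: Int_absorb1 Diff_eq Compl_eq)
    finally show "measure (product_measure u) (cyl A) = u ^ card A * (1 - u) ^ card (X - A)"
      using u by (simp add: measure_def)
  qed
  have expand: "G \<eta> = (\<Sum>A\<in>Pow X. G (\<lambda>x. x \<in> A) * indicator (cyl A) \<eta>)" for \<eta>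
  proof -
    have "\<eta> \<in> cyl A \<longleftrightarrow> A = {x\<in>X. \<eta> x}" if "A \<in> Pow X" for A
      using that by (auto simp: cyl_def)
    then have "(\<Sum>A\<in>Pow X. G (\<lambda>x. x \<in> A) * indicator (cyl A) \<eta>)
        = (\<Sum>A\<in>Pow X. if A = {x\<in>X. \<eta> x} then G (\<lambda>x. x \<in> A) else 0)"
      by (intro sum.cong refl) (auto simp: indicator_def)
    also have "\<dots> = G (\<lambda>x. x \<in> {x\<in>X. \<eta> x})" using X by (subst sum.delta) auto
    also have "\<dots> = G \<eta>" by (rule G[unfolded depends_only_on_def, rule_format]) simp
    finally show ?thesis by simp
  qed
  have "(\<integral>\<eta>. G \<eta> \<partial>product_measure u)
      = (\<integral>\<eta>. (\<Sum>A\<in>Pow X. G (\<lambda>x. x \<in> A) * indicator (cyl A) \<eta>) \<partial>product_measure u)"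
    by (rule Bochner_Integration.integral_cong[OF refl expand])
  also have "\<dots> = (\<Sum>A\<in>Pow X. G (\<lambda>x. x \<in> A) * measure (product_measure u) (cyl A))"
  proof (subst Bochner_Integration.integral_sum)
    have fin: "finite_measure (product_measure u)"
      unfolding product_measure_def by (rule P.finite_measure_axioms)
    show "integrable (product_measure u) (\<lambda>\<eta>. G (\<lambda>x. x \<in> A) * indicator (cyl A) \<eta>)" if "A \<in> Pow X" for A
      using cyl[of A] that finite_measure.emeasure_finite[OF fin]
      by (intro integrable_mult_right integrable_real_indicator) (auto simp: less_top)
    show "(\<Sum>A\<in>Pow X. \<integral>\<eta>. G (\<lambda>x. x \<in> A) * indicator (cyl A) \<eta> \<partial>product_measure u)
        = (\<Sum>A\<in>Pow X. G (\<lambda>x. x \<in> A) * measure (product_measure u) (cyl A))"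
      by (simp add: sp)
  qed
  finally show ?thesis using cyl by (simp add: poly_bernoulli_mean)
qed

section \<open>Transience in three dimensions\<close>

text \<open>
  The Taylor polynomial of degree 3 of \<open>1 / sqrt (1 + e)\<close>, with the coefficient \<open>35 / 128\<close> of the next
  term enlarged to 1, which leaves room for the higher terms.
\<close>

lemma inverse_sqrt_le_quartic:
  fixes e :: real
  assumes "\<bar>e\<bar> \<le> 1 / 4"
  shows "1 / sqrt (1 + e) \<le> 1 - e / 2 + 3 / 8 * e\<^sup>2 - 5 / 16 * e ^ 3 + e ^ 4"
proof -
  define p where "p = 1 - e / 2 + 3 / 8 * e\<^sup>2 - 5 / 16 * e ^ 3 + e ^ 4"
  have b: "\<bar>e ^ n\<bar> \<le> (1 / 4) ^ n" for n
    unfolding power_abs using assms by (intro power_mono) auto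
  have n: "e\<^sup>2 \<ge> 0" "e ^ 4 \<ge> 0" by auto
  have c: "\<bar>e ^ 1\<bar> \<le> 1 / 4" "\<bar>e\<^sup>2\<bar> \<le> 1 / 16" "\<bar>e ^ 3\<bar> \<le> 1 / 64" "\<bar>e ^ 4\<bar> \<le> 1 / 256" "\<bar>e ^ 5\<bar> \<le> 1 / 1024"
    using b[of 1] b[of 2] b[of 3] b[of 4] b[of 5] by (simp_all add: power_divide)
  have p: "p \<ge> 0" unfolding p_def using n c(1,3) by (simp only: power_one_right)
  have "p\<^sup>2 * (1 + e) = 1 + e ^ 4 * (93/64 + 39/32 * e ^ 1 - 99/256 * e ^ 2 + 57/256 * e ^ 3 + 3/8 * e ^ 4 + e ^ 5)"
    unfolding p_def by (simp add: field_simps eval_nat_numeral)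
  moreover have "93/64 + 39/32 * e ^ 1 - 99/256 * e ^ 2 + 57/256 * e ^ 3 + 3/8 * e ^ 4 + e ^ 5 \<ge> 0"
    using c by linarith
  ultimately have "1 \<le> p\<^sup>2 * (1 + e)" by simp
  then have "1 \<le> sqrt (p\<^sup>2 * (1 + e))" by simp
  also have "\<dots> = p * sqrt (1 + e)" using p by (simp add: real_sqrt_mult)
  finally show ?thesis unfolding p_def[symmetric] using c(1) by (simp add: divide_le_eq)
qed

text \<open>
  With \<open>s = 100 + q x\<close>, \<open>q = q y\<close> and \<open>b\<close> the mixed term, the left side is what one neighbor
  \<open>y\<close> and its reflection contribute to the average of \<open>1 / sqrt (100 + q)\<close>. The right side is linear in
  \<open>q\<close> and \<open>b\<^sup>2\<close>, whose sums over the neighborhood are known. The cubic term of the Taylor polynomial has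
  the right sign and is dropped.
\<close>

lemma inverse_sqrt_pair_le:
  fixes s r q b :: real
  assumes s: "s \<ge> 100" "r * s = 1" and q: "0 \<le> q" "q \<le> 1" and b: "b\<^sup>2 \<le> s"
  shows "1 / sqrt (s + q + 2 * b) + 1 / sqrt (s + q - 2 * b)
    \<le> (2 + (- r + 3 / 4 * r\<^sup>2 + 2 * r ^ 4) * q + (3 * r\<^sup>2 + 32 * r ^ 3 + 48 * r ^ 4) * b\<^sup>2) / sqrt s"
proof -
  define e where "e = q * r"
  define d where "d = 2 * b * r"
  have r: "r > 0" using s by (metis less_le_trans mult_pos_pos zero_less_mult_pos2 zero_less_numeral zero_less_one)
  have "r * 100 \<le> r * s" using s r by (intro mult_left_mono) auto
  then have r1: "r \<le> 1 / 100" using s by simp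
  have "d\<^sup>2 = 4 * b\<^sup>2 * r\<^sup>2" by (simp add: d_def power_mult_distrib)
  also have "\<dots> \<le> 4 * s * r\<^sup>2" using b by (intro mult_right_mono mult_left_mono) auto
  also have "\<dots> = 4 * r * (r * s)" by (simp add: power2_eq_square)
  also have "\<dots> \<le> (1 / 5)\<^sup>2" using r1 s by (simp add: power2_eq_square)
  finally have d: "\<bar>d\<bar> \<le> 1 / 5" using abs_le_square_iff[of d "1 / 5"] by simp
  have "q * r \<le> 1 * (1 / 100)" using q r r1 by (intro mult_mono) auto
  then have e: "0 \<le> e" "e \<le> 1 / 100" unfolding e_def using q r by auto
  have f: "1 / sqrt (s + q + c) = 1 / sqrt (1 + (e + c * r)) / sqrt s" for c
  proof -
    have "s * (1 + (e + c * r)) = s + q * (r * s) + c * (r * s)" by (simp add: e_def algebra_simps)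
    then have "s + q + c = s * (1 + (e + c * r))" unfolding s(2) by simp
    then show ?thesis by (simp only: real_sqrt_mult) simp
  qed
  let ?p = "\<lambda>e::real. 1 - e / 2 + 3 / 8 * e\<^sup>2 - 5 / 16 * e ^ 3 + e ^ 4"
  have "1 / sqrt (s + q + 2 * b) + 1 / sqrt (s + q - 2 * b)
      = (1 / sqrt (1 + (e + d)) + 1 / sqrt (1 + (e - d))) / sqrt s"
    using f[of "2 * b"] f[of "- (2 * b)"] by (simp add: d_def add_divide_distrib)
  also have "\<dots> \<le> (?p (e + d) + ?p (e - d)) / sqrt s"
  proof (intro divide_right_mono add_mono inverse_sqrt_le_quartic)
    show "\<bar>e + d\<bar> \<le> 1 / 4" "\<bar>e - d\<bar> \<le> 1 / 4" using d e by linarith+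
  qed (use s in auto)
  also have "?p (e + d) + ?p (e - d)
      = 2 - e + 3 / 8 * (2 * e\<^sup>2 + 2 * d\<^sup>2) - 5 / 8 * (e ^ 3 + 3 * e * d\<^sup>2) + 2 * (e ^ 4 + 6 * e\<^sup>2 * d\<^sup>2 + d ^ 4)"
    by (simp add: field_simps eval_nat_numeral)
  also have "\<dots> \<le> 2 + (- r + 3 / 4 * r\<^sup>2 + 2 * r ^ 4) * q + (3 * r\<^sup>2 + 32 * r ^ 3 + 48 * r ^ 4) * b\<^sup>2"
  proof -
    define X where "X = e ^ 3 + 3 * e * d\<^sup>2"
    have q2: "q\<^sup>2 \<le> q" "q ^ 4 \<le> q" "q\<^sup>2 \<le> 1"
      using q power_decreasing[of 1 2 q] power_decreasing[of 1 4 q] power_le_one[of q 2] by auto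
    have "d ^ 4 = 16 * (b\<^sup>2 * b\<^sup>2 * r ^ 4)" by (simp add: d_def power_mult_distrib power_add[symmetric])
    also have "b\<^sup>2 * b\<^sup>2 * r ^ 4 \<le> b\<^sup>2 * s * r ^ 4"
      using b r by (intro mult_right_mono mult_left_mono) auto
    also have "\<dots> = r ^ 3 * b\<^sup>2 * (r * s)" by (simp add: eval_nat_numeral)
    finally have "d ^ 4 \<le> 16 * (r ^ 3 * b\<^sup>2)" unfolding s(2) by simp
    moreover have "e\<^sup>2 \<le> r\<^sup>2 * q" "e ^ 4 \<le> r ^ 4 * q"
      using mult_right_mono[OF q2(1), of "r\<^sup>2"] mult_right_mono[OF q2(2), of "r ^ 4"]
      by (simp_all add: e_def power_mult_distrib mult.commute)
    moreover have "e\<^sup>2 * d\<^sup>2 \<le> 4 * (r ^ 4 * b\<^sup>2)"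
    proof -
      have "e\<^sup>2 * d\<^sup>2 = q\<^sup>2 * (4 * (r ^ 4 * b\<^sup>2))"
        by (simp add: e_def d_def power_mult_distrib)
      also have "\<dots> \<le> 1 * (4 * (r ^ 4 * b\<^sup>2))" using q2(3) by (rule mult_right_mono) simp
      finally show ?thesis by simp
    qed
    moreover have "d\<^sup>2 = 4 * (r\<^sup>2 * b\<^sup>2)" by (simp add: d_def power_mult_distrib)
    moreover have "X \<ge> 0" unfolding X_def using e by simp
    ultimately have "2 - e + 3 / 4 * e\<^sup>2 + 3 / 4 * d\<^sup>2 - 5 / 8 * X + 2 * e ^ 4 + 12 * (e\<^sup>2 * d\<^sup>2) + 2 * d ^ 4
        \<le> 2 - e + 3 / 4 * (r\<^sup>2 * q) + 2 * (r ^ 4 * q) + 3 * (r\<^sup>2 * b\<^sup>2) + 32 * (r ^ 3 * b\<^sup>2) + 48 * (r ^ 4 * b\<^sup>2)"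
      by linarith
    moreover have "2 - e + 3 / 8 * (2 * e\<^sup>2 + 2 * d\<^sup>2) - 5 / 8 * (e ^ 3 + 3 * e * d\<^sup>2) + 2 * (e ^ 4 + 6 * e\<^sup>2 * d\<^sup>2 + d ^ 4)
        = 2 - e + 3 / 4 * e\<^sup>2 + 3 / 4 * d\<^sup>2 - 5 / 8 * X + 2 * e ^ 4 + 12 * (e\<^sup>2 * d\<^sup>2) + 2 * d ^ 4"
      unfolding X_def[symmetric] by simp
    moreover have "2 - e + 3 / 4 * (r\<^sup>2 * q) + 2 * (r ^ 4 * q) + 3 * (r\<^sup>2 * b\<^sup>2) + 32 * (r ^ 3 * b\<^sup>2) + 48 * (r ^ 4 * b\<^sup>2)
        = 2 + (- r + 3 / 4 * r\<^sup>2 + 2 * r ^ 4) * q + (3 * r\<^sup>2 + 32 * r ^ 3 + 48 * r ^ 4) * b\<^sup>2"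
      by (simp add: e_def algebra_simps)
    ultimately show ?thesis by (simp only:)
  qed
  finally show ?thesis using s by (simp add: divide_right_mono)
qed

definition real_vec :: "site \<Rightarrow> real ^ 3" where
  "real_vec x = (\<chi> i. real_of_int (x $ i))"

lemma real_vec_add: "real_vec (x + y) = real_vec x + real_vec y"
  and real_vec_diff: "real_vec (x - y) = real_vec x - real_vec y"
  and real_vec_scale: "real_vec (c *s x) = real_of_int c *\<^sub>R real_vec x"
  and real_vec_zero: "real_vec 0 = 0"
  by (simp_all add: real_vec_def vec_eq_iff)

lemma real_vec_eq_0_iff: "real_vec x = 0 \<longleftrightarrow> x = 0"
  by (simp add: real_vec_def vec_eq_iff)

context neighborhood
begin

definition second_moment :: "real ^ 3 \<Rightarrow> real ^ 3" where
  "second_moment v = (\<Sum>y\<in>N. (v \<bullet> real_vec y) *\<^sub>R real_vec y)"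

lemma linear_second_moment: "linear second_moment"
  unfolding second_moment_def
  by (intro linearI) (simp_all add: inner_add_left scaleR_add_left sum.distrib scaleR_sum_right)

lemma second_moment_inner: "second_moment v \<bullet> w = (\<Sum>y\<in>N. (v \<bullet> real_vec y) * (w \<bullet> real_vec y))"
  unfolding second_moment_def inner_sum_left inner_scaleR_left
  by (intro sum.cong refl) (simp add: inner_commute)

text \<open>
  A vector orthogonal to \<open>N\<close> is orthogonal to the group generated by \<open>N\<close>, which contains the unit vectors.
\<close>

lemma orthogonal_to_neighborhood:
  assumes orth: "\<And>y. y \<in> N \<Longrightarrow> w \<bullet> real_vec y = 0"
  shows "w = 0"
proof -
  have "w \<bullet> real_vec x = 0" if "x \<in> group_closure N" for x
    using that by (induction) (auto simp: orth real_vec_zero real_vec_diff inner_diff_right)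
  then have "w \<bullet> real_vec (axis i 1) = 0" for i
    using generating by auto
  moreover have "real_vec (axis i 1) = axis i 1" for i
    by (simp add: real_vec_def axis_def vec_eq_iff)
  ultimately have "w $ i = 0" for i by (simp add: inner_axis)
  then show ?thesis by (simp add: vec_eq_iff)
qed

lemma inj_second_moment: "inj second_moment"
proof (rule injI)
  fix v w assume "second_moment v = second_moment w"
  then have "second_moment (v - w) = 0" by (simp add: linear_diff[OF linear_second_moment])
  then have "(\<Sum>y\<in>N. ((v - w) \<bullet> real_vec y)\<^sup>2) = 0"
    using second_moment_inner[of "v - w" "v - w"] by (simp add: power2_eq_square)
  then have "(v - w) \<bullet> real_vec y = 0" if "y \<in> N" for y
    using that finite_N by (subst (asm) sum_nonneg_eq_0_iff) auto
  then have "v - w = 0" by (rule orthogonal_to_neighborhood)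
  then show "v = w" by simp
qed

text \<open>
  The quadratic form \<open>q\<close> of the inverse \<open>J\<close> of the second moment matrix, together with its bilinear form
  \<open>b\<close>. In the coordinates that it provides the steps are isotropic: the squares of \<open>b x y\<close> sum up to
  \<open>q x\<close>, and the sum of \<open>q y\<close> is the trace of the identity, that is, the dimension 3.
\<close>

lemma covariance_form:
  obtains q :: "site \<Rightarrow> real" and b :: "site \<Rightarrow> site \<Rightarrow> real" where
    "\<And>x y. q (x + y) = q x + q y + 2 * b x y" "\<And>x y. q (x - y) = q x + q y - 2 * b x y"
    "\<And>c x. q (c *s x) = (real_of_int c)\<^sup>2 * q x" "\<And>x. x \<noteq> 0 \<Longrightarrow> q x > 0" "\<And>x. q x \<ge> 0"
    "\<And>x. (\<Sum>y\<in>N. (b x y)\<^sup>2) = q x" "(\<Sum>y\<in>N. q y) = 3" "\<And>x. b x x = q x"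
proof -
  have "surj second_moment"
    using linear_injective_imp_surjective[OF linear_second_moment inj_second_moment] by simp
  then obtain J where J: "linear J" "second_moment \<circ> J = id"
    using linear_surjective_right_inverse[OF linear_second_moment] by blast
  then have SJ: "second_moment (J v) = v" for v by (metis comp_apply id_apply)
  have form: "J v \<bullet> w = (\<Sum>y\<in>N. (J v \<bullet> real_vec y) * (J w \<bullet> real_vec y))" for v w
    using second_moment_inner[of "J w" "J v"] by (simp add: SJ inner_commute mult.commute)
  have sym: "J v \<bullet> w = J w \<bullet> v" for v w
    using form[of v w] form[of w v] by (simp only: mult.commute)
  define b where "b = (\<lambda>x y. J (real_vec x) \<bullet> real_vec y)"
  define q where "q = (\<lambda>x. b x x)"
  note lin = linear_add[OF J(1)] linear_diff[OF J(1)] linear_cmul[OF J(1)]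
  have sq: "(\<Sum>y\<in>N. (b x y)\<^sup>2) = q x" for x
    using form[of "real_vec x" "real_vec x"]
    by (simp add: b_def q_def power2_eq_square)
  show ?thesis
  proof
    show "q (x + y) = q x + q y + 2 * b x y" "q (x - y) = q x + q y - 2 * b x y" for x y
      using sym[of "real_vec x" "real_vec y"]
      by (simp_all add: q_def b_def real_vec_add real_vec_diff lin inner_add_left inner_add_right inner_diff_left inner_diff_right)
    show "q (c *s x) = (real_of_int c)\<^sup>2 * q x" for c x
      by (simp add: q_def b_def real_vec_scale lin power2_eq_square)
    show nn: "q x \<ge> 0" for x unfolding sq[symmetric] by (intro sum_nonneg) simp
    show "q x > 0" if "x \<noteq> 0" for x
    proof (rule ccontr)
      assume "\<not> q x > 0"
      then have "(\<Sum>y\<in>N. (b x y)\<^sup>2) = 0" using nn[of x] sq[of x] by simp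
      then have "b x y = 0" if "y \<in> N" for y
        using that finite_N by (subst (asm) sum_nonneg_eq_0_iff) auto
      then have "second_moment (J (real_vec x)) = 0"
        by (simp add: second_moment_def b_def)
      then show False using that by (simp add: SJ real_vec_eq_0_iff)
    qed
    show "(\<Sum>y\<in>N. (b x y)\<^sup>2) = q x" for x by (rule sq)
    have "(\<Sum>y\<in>N. q y) = (\<Sum>y\<in>N. \<Sum>e\<in>Basis. (J (real_vec y) \<bullet> e) * (real_vec y \<bullet> e))"
      unfolding q_def b_def by (intro sum.cong refl euclidean_inner)
    also have "\<dots> = (\<Sum>e\<in>Basis. \<Sum>y\<in>N. (J e \<bullet> real_vec y) * (e \<bullet> real_vec y))"
    proof (subst sum.swap, intro sum.cong refl)
      fix e y
      show "(J (real_vec y) \<bullet> e) * (real_vec y \<bullet> e) = (J e \<bullet> real_vec y) * (e \<bullet> real_vec y)"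
        using sym[of "real_vec y" e] by (simp add: inner_commute)
    qed
    also have "\<dots> = (\<Sum>e\<in>Basis. e \<bullet> (e :: real ^ 3))"
      by (simp only: second_moment_inner[symmetric] SJ)
    also have "\<dots> = 3" by (simp add: inner_Basis)
    finally show "(\<Sum>y\<in>N. q y) = 3" .
    show "b x x = q x" for x by (simp add: q_def)
  qed
qed

end

context neighborhood
begin

text \<open>
  The function is \<open>10 / sqrt (100 + q x)\<close>, a smoothed Green function. Write \<open>s = 100 + q x\<close> and
  \<open>r = 1 / s\<close>, and expand \<open>1 / sqrt s\<close>. The terms of order \<open>r\<close> cancel exactly in dimension 3, because
  \<open>q\<close> sums up to 3. At order \<open>r\<^sup>2\<close> the constant 100 contributes \<open>- 300\<close>, which outweighs the
  positive contributions \<open>32\<close> and \<open>9 / 4\<close> of the remainder.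
\<close>

lemma transience:
  obtains g :: "site \<Rightarrow> real" where "g 0 = 1" "\<And>x. 0 \<le> g x"
    "\<And>x. (\<Sum>y\<in>N. g (x + y) + g (x - y)) \<le> 2 * real (card N) * g x"
    "\<And>x. x \<noteq> 0 \<Longrightarrow> (\<lambda>n. g (int n *s x)) \<longlonglongrightarrow> 0"
proof -
  obtain q b where q:
    "\<And>x y. q (x + y) = q x + q y + 2 * b x y" "\<And>x y. q (x - y) = q x + q y - 2 * b x y"
    "\<And>c x. q (c *s x) = (real_of_int c)\<^sup>2 * q x" "\<And>x. x \<noteq> 0 \<Longrightarrow> q x > 0" "\<And>x. q x \<ge> 0"
    "\<And>x. (\<Sum>y\<in>N. (b x y)\<^sup>2) = q x" "(\<Sum>y\<in>N. q y) = 3" "\<And>x. b x x = q x"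
    by (rule covariance_form) (rule that)
  have bq: "(b x y)\<^sup>2 \<le> q x" if "y \<in> N" for x y
    unfolding q(6)[of x, symmetric] by (rule member_le_sum) (use that finite_N in auto)
  have q1: "q y \<le> 1" if "y \<in> N" for y
  proof (rule ccontr)
    assume "\<not> q y \<le> 1"
    then have "1 * q y < q y * q y" by (intro mult_strict_right_mono) auto
    then show False using bq[OF that, of y] by (simp add: q(8) power2_eq_square)
  qed
  define g where "g = (\<lambda>x. 10 / sqrt (100 + q x))"
  show ?thesis
  proof
    show "g 0 = 1" using q(3)[of 0 0] by (simp add: g_def)
    show "0 \<le> g x" for x using q(5)[of x] by (simp add: g_def)
    show "(\<Sum>y\<in>N. g (x + y) + g (x - y)) \<le> 2 * real (card N) * g x" for x
    proof -
      define s where "s = 100 + q x"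
      have s: "s \<ge> 100" using q(5)[of x] by (simp add: s_def)
      define r where "r = 1 / s"
      define \<alpha> where "\<alpha> = - r + 3 / 4 * r\<^sup>2 + 2 * r ^ 4"
      define \<beta> where "\<beta> = 3 * r\<^sup>2 + 32 * r ^ 3 + 48 * r ^ 4"
      have r: "r > 0" "r * s = 1" using s by (simp_all add: r_def)
      have "(\<Sum>y\<in>N. 1 / sqrt (100 + q (x + y)) + 1 / sqrt (100 + q (x - y)))
        \<le> (\<Sum>y\<in>N. (2 + \<alpha> * q y + \<beta> * (b x y)\<^sup>2) / sqrt s)"
      proof (rule sum_mono)
        fix y assume y: "y \<in> N"
        have e: "100 + q (x + y) = s + q y + 2 * b x y" "100 + q (x - y) = s + q y - 2 * b x y"
          by (simp_all add: q(1,2) s_def)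
        show "1 / sqrt (100 + q (x + y)) + 1 / sqrt (100 + q (x - y)) \<le> (2 + \<alpha> * q y + \<beta> * (b x y)\<^sup>2) / sqrt s"
          unfolding e \<alpha>_def \<beta>_def
          by (rule inverse_sqrt_pair_le[OF s r(2) q(5) q1[OF y]]) (use bq[OF y, of x] in \<open>simp add: s_def\<close>)
      qed
      also have "\<dots> = (2 * real (card N) + (3 * \<alpha> + \<beta> * q x)) / sqrt s"
        unfolding sum_divide_distrib[symmetric] sum.distrib sum_distrib_left[symmetric] q(6,7) by simp
      also have "\<dots> \<le> 2 * real (card N) / sqrt s"
      proof (rule divide_right_mono)
        have "\<beta> * q x = 3 * r * (r * s) + 32 * r\<^sup>2 * (r * s) + 48 * r ^ 3 * (r * s) - 100 * \<beta>"
          by (simp add: s_def \<beta>_def algebra_simps eval_nat_numeral)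
        then have "3 * \<alpha> + \<beta> * q x = - (1063 / 4) * r\<^sup>2 - 3152 * r ^ 3 - 4794 * r ^ 4"
          unfolding r(2) \<alpha>_def \<beta>_def by simp
        also have "\<dots> \<le> 0" using r(1) zero_le_power[of r 2] zero_le_power[of r 3] zero_le_power[of r 4] by linarith
        finally show "2 * real (card N) + (3 * \<alpha> + \<beta> * q x) \<le> 2 * real (card N)" by simp
      qed (use s in simp)
      finally have "10 * (\<Sum>y\<in>N. 1 / sqrt (100 + q (x + y)) + 1 / sqrt (100 + q (x - y)))
          \<le> 10 * (2 * real (card N) / sqrt s)" by (rule mult_left_mono) simp
      then show ?thesis
        unfolding g_def sum_distrib_left distrib_left s_def[symmetric] by (simp add: mult_ac)
    qed
    show "(\<lambda>n. g (int n *s x)) \<longlonglongrightarrow> 0" if "x \<noteq> 0" for x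
    proof -
      have "filterlim (\<lambda>n. 100 + (real n)\<^sup>2 * q x) at_top sequentially"
        by (intro filterlim_tendsto_add_at_top[OF tendsto_const] filterlim_at_top_mult_tendsto_pos[OF tendsto_const]
              filterlim_pow_at_top filterlim_real_sequentially q(4) that) simp
      then have "filterlim (\<lambda>n. sqrt (100 + (real n)\<^sup>2 * q x)) at_top sequentially"
        by (rule filterlim_compose[OF sqrt_at_top])
      then have "(\<lambda>n. 10 / sqrt (100 + (real n)\<^sup>2 * q x)) \<longlonglongrightarrow> 0"
        by (rule tendsto_divide_0[OF tendsto_const filterlim_at_top_imp_at_infinity])
      then show ?thesis by (simp add: g_def q(3))
    qed
  qed
qed

text \<open>
  Only jumps from the sites of the two walkers change their difference, by \<open>y\<close> or by \<open>- y\<close> for a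
  uniformly chosen \<open>y\<close>.
\<close>

lemma dual_step_pair:
  assumes ij: "i \<in> I" "j \<in> I" "z i \<noteq> z j"
    and g: "\<And>x. (\<Sum>y\<in>N. g (x + y) + g (x - y)) \<le> 2 * real (card N) * g x"
  shows "dual_step (\<lambda>z. g (z i - z j)) z \<le> g (z i - z j)"
proof -
  let ?d = "z i - z j"
  define D where "D = (\<lambda>x. \<Sum>y\<in>N. g (jump z x y i - jump z x y j) - g ?d)"
  have "(\<Sum>x\<in>z ` I. D x / real (card N)) = (\<Sum>x\<in>{z i, z j}. D x / real (card N))"
  proof (rule sum.mono_neutral_right)
    show "finite (z ` I)" using finite_N by simp
    show "{z i, z j} \<subseteq> z ` I" using ij(1,2) by blast
    show "\<forall>x\<in>z ` I - {z i, z j}. D x / real (card N) = 0"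
    proof
      fix x assume "x \<in> z ` I - {z i, z j}"
      then have "x \<notin> {z i, z j}" by blast
      then have "z i \<noteq> x" "z j \<noteq> x" by blast+
      then have "D x = 0" unfolding D_def jump_def by simp
      then show "D x / real (card N) = 0" by simp
    qed
  qed
  also have "\<dots> = (D (z i) + D (z j)) / real (card N)"
    using ij(3) by (simp add: add_divide_distrib)
  also have "D (z i) + D (z j) = (\<Sum>y\<in>N. g (?d + y) + g (?d - y)) - 2 * real (card N) * g ?d"
    using ij(3) by (simp add: D_def jump_def sum_subtractf sum.distrib algebra_simps)
  also have "\<dots> / real (card N) \<le> 0"
    using g[of ?d] by (simp add: divide_nonpos_nonneg)
  finally have "clock_rate * (dual_step (\<lambda>z. g (z i - z j)) z - g ?d) \<le> 0"
    by (simp only: D_def dual_step_generator[of "\<lambda>z. g (z i - z j)"])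
  then show ?thesis using clock_rate_pos by (simp add: mult_le_0_iff)
qed

lemma dual_step_diff: "dual_step (\<lambda>z. \<phi> z - \<psi> z) z = dual_step \<phi> z - dual_step \<psi> z"
  using dual_step_linear[of 1 \<phi> \<psi> z] by simp

lemma dual_step_pos:
  assumes "\<And>z. \<phi> z \<ge> 0" "x \<in> z ` I" "y \<in> N" "\<phi> (jump z x y) > 0"
  shows "dual_step \<phi> z > 0"
proof -
  have "\<phi> (jump z x y) \<le> (\<Sum>y\<in>N. \<phi> (jump z x y))"
    by (rule member_le_sum) (use assms finite_N in auto)
  also have "\<dots> \<le> (\<Sum>x\<in>z ` I. \<Sum>y\<in>N. \<phi> (jump z x y))"
    by (rule member_le_sum) (use assms finite_N in \<open>auto intro!: sum_nonneg\<close>)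
  finally have "(\<Sum>x\<in>z ` I. \<Sum>y\<in>N. \<phi> (jump z x y)) / (clock_rate * real (card N)) > 0"
    using assms(4) clock_rate_pos card_N_pos by (intro divide_pos_pos) auto
  moreover have "(1 - real (card (z ` I)) / clock_rate) * \<phi> z \<ge> 0"
    by (rule mult_nonneg_nonneg[OF stay_prob_nonneg assms(1)])
  ultimately show ?thesis unfolding dual_step_def by linarith
qed

lemma non_parallel_neighbors:
  obtains y\<^sub>1 y\<^sub>2 where "y\<^sub>1 \<in> N" "y\<^sub>2 \<in> N"
    "\<And>m n. m > 0 \<Longrightarrow> n > 0 \<Longrightarrow> int m *s y\<^sub>1 \<noteq> int n *s y\<^sub>2"
proof -
  obtain y\<^sub>1 where y1: "y\<^sub>1 \<in> N" using card_N by fastforce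
  obtain w where w: "w \<noteq> 0" "real_vec y\<^sub>1 \<bullet> w = 0"
    using orthogonal_to_vector_exists[of "real_vec y\<^sub>1"] by (auto simp: orthogonal_def)
  obtain y\<^sub>2 where y2: "y\<^sub>2 \<in> N" "w \<bullet> real_vec y\<^sub>2 \<noteq> 0"
    using orthogonal_to_neighborhood w(1) by blast
  show ?thesis
  proof (rule that[OF y1 y2(1)])
    fix m n :: nat assume "m > 0" "n > 0"
    show "int m *s y\<^sub>1 \<noteq> int n *s y\<^sub>2"
    proof
      assume "int m *s y\<^sub>1 = int n *s y\<^sub>2"
      then have "real_vec (int m *s y\<^sub>1) \<bullet> w = real_vec (int n *s y\<^sub>2) \<bullet> w" by simp
      then show False using w y2 \<open>n > 0\<close> by (simp add: real_vec_scale inner_commute)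
    qed
  qed
qed

text \<open>
  The walkers started at neighbors are grouped by their current position; the group that has joined the
  walker of the origin is left out.
\<close>

definition blocks :: "(site \<Rightarrow> site) \<Rightarrow> site set set" where
  "blocks z = (\<lambda>x. {y \<in> N. z y = x}) ` (z ` N - {z 0})"

lemma finite_blocks: "finite (blocks z)"
  unfolding blocks_def using finite_N by simp

lemma inj_on_fibre: "inj_on (\<lambda>x. {y \<in> N. z y = x}) (z ` N - {z 0})"
  by (auto simp: inj_on_def)

text \<open>
  For three walkers, 1 minus the sum of \<open>g\<close> over the pairs is subharmonic while the walkers are distinct,
  and so is its positive part \<open>h\<close>, which vanishes once two of them have met because \<open>g 0 = 1\<close>. Therefore
  the mean of \<open>h\<close> never decreases, and it only has to become positive once. To this end two walkers move far
  away along non-parallel neighbors while the third one stays at the origin.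
\<close>

lemma survival:
  obtains h :: "(site \<Rightarrow> site) \<Rightarrow> real" and \<delta> M where
    "\<And>z. 0 \<le> h z" "\<And>z. h z \<le> (if card (blocks z) \<ge> 2 then 1 else 0)" "\<delta> > 0"
    "\<And>n. n \<ge> M \<Longrightarrow> \<delta> \<le> (dual_step ^^ n) h id"
proof -
  obtain g where g: "g 0 = 1" "\<And>x. 0 \<le> g x"
    "\<And>x. (\<Sum>y\<in>N. g (x + y) + g (x - y)) \<le> 2 * real (card N) * g x"
    "\<And>x. x \<noteq> 0 \<Longrightarrow> (\<lambda>n. g (int n *s x)) \<longlonglongrightarrow> 0"
    by (rule transience) (rule that)
  obtain y\<^sub>1 y\<^sub>2 where y: "y\<^sub>1 \<in> N" "y\<^sub>2 \<in> N"
    and np: "\<And>m n. m > 0 \<Longrightarrow> n > 0 \<Longrightarrow> int m *s y\<^sub>1 \<noteq> int n *s y\<^sub>2"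
    by (rule non_parallel_neighbors) (rule that)
  have y0: "y\<^sub>1 \<noteq> 0" "y\<^sub>2 \<noteq> 0" and y12: "y\<^sub>1 \<noteq> y\<^sub>2"
    using y zero_notin np[of 1 1] by auto
  define l where "l = (\<lambda>z. 1 - g (z y\<^sub>1 - z 0) - g (z y\<^sub>2 - z 0) - g (z y\<^sub>1 - z y\<^sub>2))"
  define h where "h = (\<lambda>z. max 0 (l z))"
  have h0: "0 \<le> h z" for z by (simp add: h_def)
  have distinct: "z y\<^sub>1 \<noteq> z 0" "z y\<^sub>2 \<noteq> z 0" "z y\<^sub>1 \<noteq> z y\<^sub>2" if "h z > 0" for z
    using that g(1) g(2)[of "z y\<^sub>1 - z 0"] g(2)[of "z y\<^sub>2 - z 0"] g(2)[of "z y\<^sub>1 - z y\<^sub>2"]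
    by (auto simp: h_def l_def)
  have h1: "h z \<le> (if card (blocks z) \<ge> 2 then 1 else 0)" for z
  proof (cases "h z > 0")
    case True
    have "card {z y\<^sub>1, z y\<^sub>2} \<le> card (z ` N - {z 0})"
      by (rule card_mono) (use finite_N y distinct[OF True] in auto)
    then have "card (blocks z) \<ge> 2"
      using distinct[OF True] unfolding blocks_def card_image[OF inj_on_fibre] by simp
    moreover have "h z \<le> 1"
      using g(2)[of "z y\<^sub>1 - z 0"] g(2)[of "z y\<^sub>2 - z 0"] g(2)[of "z y\<^sub>1 - z y\<^sub>2"] by (auto simp: h_def l_def)
    ultimately show ?thesis by simp
  qed auto
  have sub: "h z \<le> dual_step h z" for z
  proof (cases "h z > 0")
    case True
    have "l z \<le> dual_step l z"
      unfolding l_def dual_step_diff dual_step_const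
      using dual_step_pair[of y\<^sub>1 0 z g] dual_step_pair[of y\<^sub>2 0 z g] dual_step_pair[of y\<^sub>1 y\<^sub>2 z g]
        y distinct[OF True] g(3) by fastforce
    also have "\<dots> \<le> dual_step h z" by (rule dual_step_mono) (simp add: h_def)
    finally show ?thesis using True by (simp add: h_def)
  next
    case False
    then show ?thesis using dual_step_mono[of "\<lambda>_. 0" h z] h0 by (simp add: dual_step_const)
  qed
  have mono: "(dual_step ^^ m) h z \<le> (dual_step ^^ n) h z" if "m \<le> n" for m n z
    using that
  proof (rule lift_Suc_mono_le[rotated])
    show "(dual_step ^^ n) h z \<le> (dual_step ^^ Suc n) h z" for n
      unfolding funpow_Suc_right comp_def by (rule dual_steps_mono[OF sub])
  qed
  have nn: "(dual_step ^^ n) h z \<ge> 0" for n z using mono[of 0 n z] h0[of z] by simp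
  have "(\<lambda>n. 1 - g (int n *s y\<^sub>1) - g (int n *s y\<^sub>2) - g (int n *s (y\<^sub>1 - y\<^sub>2))) \<longlonglongrightarrow> 1 - 0 - 0 - 0"
    by (intro tendsto_intros g(4)) (use y0 y12 in auto)
  then have "\<forall>\<^sub>F n in sequentially. 1 - g (int n *s y\<^sub>1) - g (int n *s y\<^sub>2) - g (int n *s (y\<^sub>1 - y\<^sub>2)) > 0"
    by (rule order_tendstoD(1)) simp
  then obtain n0 where n0: "\<And>n. n \<ge> n0 \<Longrightarrow> 1 - g (int n *s y\<^sub>1) - g (int n *s y\<^sub>2) - g (int n *s (y\<^sub>1 - y\<^sub>2)) > 0"
    by (auto simp: eventually_sequentially)
  \<comment> \<open>At least 1, because the walk below starts with both walkers one step away from the origin.\<close>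
  define L where "L = Suc n0"
  have far: "h z > 0" if "z 0 = 0" "z y\<^sub>1 = int L *s y\<^sub>1" "z y\<^sub>2 = int L *s y\<^sub>2" for z
  proof -
    have "int L *s y\<^sub>1 - int L *s y\<^sub>2 = int L *s (y\<^sub>1 - y\<^sub>2)" by (simp add: vec_eq_iff algebra_simps)
    then show ?thesis using n0[of L] that by (simp add: h_def l_def L_def)
  qed
  have step: "int (Suc m) *s x = int m *s x + x" for m and x :: site
    by (simp add: vec_eq_iff algebra_simps)
  have nz: "int m *s y\<^sub>1 \<noteq> 0" "int m *s y\<^sub>2 \<noteq> 0" if "m > 0" for m
    using y0 that by (auto simp: vec_eq_iff)
  \<comment> \<open>Induction on the number of jumps that are left before both walkers are \<open>L\<close> steps away.\<close>
  have reach: "\<exists>n. (dual_step ^^ n) h z > 0"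
    if "z 0 = 0" "z y\<^sub>1 = int a *s y\<^sub>1" "z y\<^sub>2 = int b *s y\<^sub>2" "0 < a" "a \<le> L" "0 < b" "b \<le> L" for z a b
    using that
  proof (induction "(L - a) + (L - b)" arbitrary: z a b)
    case 0
    then have "a = L" "b = L" by auto
    then have "h z > 0" using far[of z] 0 by auto
    then show ?case by (intro exI[of _ 0]) simp
  next
    case (Suc d)
    have propagate: "\<exists>n. (dual_step ^^ n) h z > 0" if iv: "i \<in> I" "v \<in> N" "\<exists>n. (dual_step ^^ n) h (jump z (z i) v) > 0" for i v
    proof -
      obtain n where "(dual_step ^^ n) h (jump z (z i) v) > 0" using iv by blast
      then have "dual_step ((dual_step ^^ n) h) z > 0"
        by (intro dual_step_pos[of _ "z i" z v] nn) (use iv in auto)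
      then show ?thesis by (intro exI[of _ "Suc n"]) simp
    qed
    show ?case
    proof (cases "a < L")
      case True
      have "\<exists>n. (dual_step ^^ n) h (jump z (z y\<^sub>1) y\<^sub>1) > 0"
        by (rule Suc.hyps(1)[of "Suc a" b])
           (use Suc True np[of a b] nz[of a] in \<open>auto simp: jump_def step simp del: of_nat_Suc\<close>)
      then show ?thesis using propagate[of y\<^sub>1 y\<^sub>1] y by simp
    next
      case False
      have "\<exists>n. (dual_step ^^ n) h (jump z (z y\<^sub>2) y\<^sub>2) > 0"
        by (rule Suc.hyps(1)[of a "Suc b"])
           (use Suc False np[of a b] nz[of b] in \<open>auto simp: jump_def step simp del: of_nat_Suc\<close>)
      then show ?thesis using propagate[of y\<^sub>2 y\<^sub>2] y by simp
    qed
  qed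
  obtain M where M: "(dual_step ^^ M) h id > 0"
    using reach[of id 1 1] by (auto simp: L_def)
  show ?thesis
    by (rule that[OF h0 h1 M]) (use mono in blast)
qed

end

section \<open>The reaction function of an equilibrium\<close>

lemma convergent_subsequence_finite_family:
  fixes a :: "nat \<Rightarrow> 'b \<Rightarrow> real"
  assumes "finite S" "\<And>n B. B \<in> S \<Longrightarrow> a n B \<in> {0..1}"
  obtains \<sigma> l where "strict_mono (\<sigma> :: nat \<Rightarrow> nat)" "\<And>B. B \<in> S \<Longrightarrow> (\<lambda>n. a (\<sigma> n) B) \<longlonglongrightarrow> l B"
proof -
  have "\<exists>\<sigma> l. strict_mono (\<sigma> :: nat \<Rightarrow> nat) \<and> (\<forall>B\<in>S. (\<lambda>n. a (\<sigma> n) B) \<longlonglongrightarrow> l B)"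
    using assms
  proof (induction S)
    case empty
    show ?case by (rule exI[of _ id]) (simp add: strict_mono_def)
  next
    case (insert B S)
    then obtain \<sigma> l where \<sigma>: "strict_mono (\<sigma> :: nat \<Rightarrow> nat)" "\<forall>B\<in>S. (\<lambda>n. a (\<sigma> n) B) \<longlonglongrightarrow> l B"
      by auto
    have "seq_compact {0..1::real}" by (simp add: compact_imp_seq_compact)
    then obtain x \<tau> where \<tau>: "strict_mono (\<tau> :: nat \<Rightarrow> nat)" "((\<lambda>n. a (\<sigma> n) B) \<circ> \<tau>) \<longlonglongrightarrow> x"
      using insert.prems by (auto elim!: seq_compactE[where f="\<lambda>n. a (\<sigma> n) B"])
    have "(\<lambda>n. a ((\<sigma> \<circ> \<tau>) n) C) \<longlonglongrightarrow> (l(B := x)) C" if "C \<in> insert B S" for C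
    proof (cases "C = B")
      case True
      then show ?thesis using \<tau>(2) by (simp add: o_def)
    next
      case False
      then have "(\<lambda>n. a (\<sigma> n) C) \<longlonglongrightarrow> l C" using \<sigma> that by auto
      from LIMSEQ_subseq_LIMSEQ[OF this \<tau>(1)] show ?thesis using False by (simp add: o_def)
    qed
    then show ?case using strict_mono_o[OF \<sigma>(1) \<tau>(1)] by blast
  qed
  then show ?thesis using that by blast
qed

context neighborhood
begin

text \<open>
  The rate at which the perturbation creates the opinion 1 at the origin, minus the rate at which it
  destroys it. The reaction function is its expectation.
\<close>

definition observable :: "config \<Rightarrow> real" where
  "observable \<eta> = (if \<eta> 0 then - coeff_q_less_1 (card N) (card {y\<in>N. \<not> \<eta> y})
     else coeff_q_less_1 (card N) (card {y\<in>N. \<eta> y}))"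

lemma observable_depends: "depends_only_on observable I"
proof -
  have "observable \<eta> = observable \<zeta>" if "\<forall>x\<in>I. \<eta> x = \<zeta> x" for \<eta> \<zeta>
  proof -
    have "{y\<in>N. \<eta> y} = {y\<in>N. \<zeta> y}" "{y\<in>N. \<not> \<eta> y} = {y\<in>N. \<not> \<zeta> y}" using that by auto
    then show ?thesis using that by (simp add: observable_def)
  qed
  then show ?thesis by (simp add: depends_only_on_def)
qed

lemma observable_bounded: "\<bar>observable \<eta>\<bar> \<le> (\<Sum>m\<le>card N. \<bar>coeff_q_less_1 (card N) m\<bar>)"
proof -
  have "\<bar>coeff_q_less_1 (card N) (card S)\<bar> \<le> (\<Sum>m\<le>card N. \<bar>coeff_q_less_1 (card N) m\<bar>)" if "S \<subseteq> N" for S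
    using card_mono[OF finite_N that] by (intro member_le_sum[of "card S"]) auto
  from this[of "{y\<in>N. \<not> \<eta> y}"] this[of "{y\<in>N. \<eta> y}"] show ?thesis by (simp add: observable_def)
qed

text \<open>
  The sum omits \<open>m = 0\<close> and \<open>m = card N\<close>, where the coefficient is 0.
\<close>

lemma observable_eq_sum:
  "observable \<eta> = (\<Sum>m = 1..card N - 1. coeff_q_less_1 (card N) m *
     (indicator {\<eta>. \<eta> 0 = False \<and> card {y \<in> N. \<eta> y = (\<not> False)} = m} \<eta>
      - indicator {\<eta>. \<eta> 0 = True \<and> card {y \<in> N. \<eta> y = (\<not> True)} = m} \<eta>))"
proof -
  have pick: "(\<Sum>m = 1..card N - 1. coeff_q_less_1 (card N) m * (if c = m then 1 else 0)) = coeff_q_less_1 (card N) c"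
    if "c \<le> card N" for c
  proof -
    have "(\<Sum>m = 1..card N - 1. coeff_q_less_1 (card N) m * (if c = m then 1 else 0))
        = (\<Sum>m = 1..card N - 1. if c = m then coeff_q_less_1 (card N) m else 0)"
      by (intro sum.cong) auto
    also have "\<dots> = (if c \<in> {1..card N - 1} then coeff_q_less_1 (card N) c else 0)"
      by (simp only: sum.delta' finite_atLeastAtMost)
    also have "\<dots> = coeff_q_less_1 (card N) c"
    proof (cases "c \<in> {1..card N - 1}")
      case False
      then have "c = 0 \<or> c = card N" using that by auto
      then have "coeff_q_less_1 (card N) c = 0" using card_N_pos by (auto simp: coeff_q_less_1_def)
      then show ?thesis using False by simp
    qed simp
    finally show ?thesis .
  qed
  have le: "card {y\<in>N. \<not> \<eta> y} \<le> card N" "card {y\<in>N. \<eta> y} \<le> card N"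
    using finite_N by (auto intro: card_mono)
  show ?thesis
  proof (cases "\<eta> 0")
    case True
    then have "observable \<eta> = - (\<Sum>m = 1..card N - 1. coeff_q_less_1 (card N) m * (if card {y\<in>N. \<not> \<eta> y} = m then 1 else 0))"
      unfolding pick[OF le(1)] by (simp only: observable_def if_True)
    then show ?thesis
      unfolding sum_negf[symmetric] by (rule trans) (intro sum.cong refl, simp add: True indicator_def)
  next
    case False
    then have "observable \<eta> = (\<Sum>m = 1..card N - 1. coeff_q_less_1 (card N) m * (if card {y\<in>N. \<eta> y} = m then 1 else 0))"
      unfolding pick[OF le(2)] by (simp only: observable_def if_False)
    then show ?thesis
      by (rule trans) (intro sum.cong refl, simp add: False indicator_def)
  qed
qed

text \<open>
  The domain of the generator consists of continuous functions and contains all functions of finitely many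
  sites.
\<close>

lemma continuous_local:
  assumes "voter_model N P" "finite A" "depends_only_on f A"
  shows "continuous_on UNIV f"
  using assms unfolding voter_model_def generator_maps_def by blast

lemma reaction_eq_integral:
  assumes P: "voter_model N P" and \<nu>: "prob_space \<nu>" "sets \<nu> = sets borel"
  shows "reaction coeff_q_less_1 N \<nu> = (\<integral>\<eta>. observable \<eta> \<partial>\<nu>)"
proof -
  interpret prob_space \<nu> by fact
  define E where "E = (\<lambda>i m. {\<eta>::config. \<eta> 0 = i \<and> card {y \<in> N. \<eta> y = (\<not> i)} = m})"
  have E: "E i m \<in> sets \<nu>" for i m
  proof -
    have "indicator (E i m) \<eta> = (indicator (E i m) \<zeta> :: real)" if "\<forall>x\<in>I. \<eta> x = \<zeta> x" for \<eta> \<zeta>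
    proof -
      have "{y \<in> N. \<eta> y = (\<not> i)} = {y \<in> N. \<zeta> y = (\<not> i)}" using that by auto
      then show ?thesis using that by (simp add: E_def indicator_def)
    qed
    then have "continuous_on UNIV (indicator (E i m) :: config \<Rightarrow> real)"
      by (intro continuous_local[OF P, of I]) (auto simp: depends_only_on_def finite_N)
    then have "(indicator (E i m) :: config \<Rightarrow> real) \<in> borel_measurable borel"
      by (rule borel_measurable_continuous_onI)
    then have "E i m \<in> sets borel" by (simp add: borel_measurable_indicator_iff)
    then show ?thesis using \<nu> by simp
  qed
  have sp: "space \<nu> = UNIV" using sets_eq_imp_space_eq[OF \<nu>(2)] by simp
  have "(\<integral>\<eta>. observable \<eta> \<partial>\<nu>) = (\<integral>\<eta>. (\<Sum>m = 1..card N - 1. coeff_q_less_1 (card N) m *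
      (indicator (E False m) \<eta> - indicator (E True m) \<eta>)) \<partial>\<nu>)"
    unfolding E_def by (rule Bochner_Integration.integral_cong[OF refl observable_eq_sum])
  also have "\<dots> = (\<Sum>m = 1..card N - 1. coeff_q_less_1 (card N) m * (prob (E False m) - prob (E True m)))"
    using E by (simp add: sp emeasure_eq_measure)
  finally show ?thesis by (simp add: reaction_def disagreement_prob_def E_def)
qed

lemma card_eq_sum_fibres:
  assumes "A \<subseteq> z ` N - {z 0}"
  shows "card {y\<in>N. z y \<in> A} = (\<Sum>b\<in>(\<lambda>x. {y \<in> N. z y = x}) ` A. card b)"
proof -
  have "finite A" using assms finite_N finite_subset by blast
  moreover have "{y\<in>N. z y \<in> A} = (\<Union>x\<in>A. {y \<in> N. z y = x})" by auto
  ultimately have "card {y\<in>N. z y \<in> A} = (\<Sum>x\<in>A. card {y \<in> N. z y = x})"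
    using finite_N by (simp add: card_UN_disjoint disjoint_iff)
  also have "\<dots> = (\<Sum>b\<in>(\<lambda>x. {y \<in> N. z y = x}) ` A. card b)"
    by (subst sum.reindex[OF inj_on_subset[OF inj_on_fibre assms]]) simp
  finally show ?thesis .
qed

abbreviation drift_quotient :: "site set set \<Rightarrow> real poly" where
  "drift_quotient B \<equiv> reflection_quotient (block_poly (card N) B)"

text \<open>
  Condition on the opinion at the origin. If it is 0, the disagreeing blocks are those with opinion 1, and
  their mean contribution is \<open>u\<close> times the block polynomial; if it is 1, the roles of \<open>u\<close> and
  \<open>1 - u\<close> are exchanged.
\<close>

lemma integral_observable:
  assumes u: "u \<in> {0..1}"
  shows "(\<integral>\<eta>. observable (\<eta> \<circ> z) \<partial>product_measure u)
    = u * (1 - u) * (1 - 2 * u) * poly (drift_quotient (blocks z)) u"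
proof -
  define X where "X = z ` N - {z 0}"
  define R where "R = (\<lambda>A. coeff_q_less_1 (card N) (\<Sum>b\<in>(\<lambda>x. {y \<in> N. z y = x}) ` A. card b))"
  have fin: "finite X" and new: "z 0 \<notin> X" and im: "z ` I = insert (z 0) X"
    using finite_N by (auto simp: X_def)
  have R: "coeff_q_less_1 (card N) (card {y\<in>N. z y \<in> A}) = R A" if "A \<subseteq> X" for A
    using card_eq_sum_fibres[of A z] that by (simp add: R_def X_def)
  have "depends_only_on (\<lambda>\<eta>. observable (\<eta> \<circ> z)) (insert (z 0) X)"
    using observable_depends unfolding im[symmetric] by (auto simp: depends_only_on_def)
  then have "(\<integral>\<eta>. observable (\<eta> \<circ> z) \<partial>product_measure u)
      = poly (bernoulli_mean (insert (z 0) X) (\<lambda>A. observable ((\<lambda>x. x \<in> A) \<circ> z))) u"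
    using fin u by (intro integral_product_measure) auto
  also have "\<dots> = u * poly (bernoulli_mean X (\<lambda>A. observable ((\<lambda>x. x \<in> insert (z 0) A) \<circ> z))) u
      + (1 - u) * poly (bernoulli_mean X (\<lambda>A. observable ((\<lambda>x. x \<in> A) \<circ> z))) u"
    unfolding bernoulli_mean_insert[OF fin new] by (simp add: algebra_simps)
  also have "bernoulli_mean X (\<lambda>A. observable ((\<lambda>x. x \<in> A) \<circ> z)) = bernoulli_mean X R"
  proof (rule bernoulli_mean_cong)
    fix A assume "A \<subseteq> X"
    then have "z 0 \<notin> A" using new by auto
    then show "observable ((\<lambda>x. x \<in> A) \<circ> z) = R A"
      using R[OF \<open>A \<subseteq> X\<close>] by (simp add: observable_def)
  qed
  also have "bernoulli_mean X (\<lambda>A. observable ((\<lambda>x. x \<in> insert (z 0) A) \<circ> z))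
      = bernoulli_mean X (\<lambda>A. - R (X - A))"
  proof (rule bernoulli_mean_cong)
    fix A assume "A \<subseteq> X"
    have "{y\<in>N. z y \<notin> insert (z 0) A} = {y\<in>N. z y \<in> X - A}" by (auto simp: X_def)
    then show "observable ((\<lambda>x. x \<in> insert (z 0) A) \<circ> z) = - R (X - A)"
      using R[of "X - A"] by (simp add: observable_def)
  qed
  also have "poly (bernoulli_mean X (\<lambda>A. - R (X - A))) u = - poly (bernoulli_mean X R) (1 - u)"
    unfolding poly_bernoulli_mean_reflect[OF fin] by (simp add: poly_bernoulli_mean sum_negf)
  also have "bernoulli_mean X R = [:0, 1:] * block_poly (card N) (blocks z)"
    unfolding bernoulli_mean_coeff_q_less_1[OF finite_blocks, symmetric]
    unfolding blocks_def X_def R_def by (rule bernoulli_mean_reindex[OF inj_on_fibre, symmetric])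
  also have "u * - poly ([:0, 1:] * block_poly (card N) (blocks z)) (1 - u)
      + (1 - u) * poly ([:0, 1:] * block_poly (card N) (blocks z)) u
      = u * (1 - u) * (poly (block_poly (card N) (blocks z)) u - poly (block_poly (card N) (blocks z)) (1 - u))"
    by (simp add: algebra_simps)
  finally show ?thesis unfolding reflection_quotient[symmetric] by (simp only: mult.assoc)
qed

lemma drift_quotient_nonneg:
  assumes B: "B \<subseteq> Pow N - {{}}" and u: "u \<in> {0..1}"
  shows "poly (drift_quotient B) u \<ge> 0" "card B \<ge> 2 \<Longrightarrow> poly (drift_quotient B) u > 0"
proof -
  have fB: "finite B" using B finite_N by (meson finite_Diff finite_Pow_iff finite_subset)
  have pos: "card b > 0" if "b \<in> B" for b
    using that B finite_N by (auto simp: card_gt_0_iff intro: finite_subset)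
  have k: "card N > 0" using card_N by simp
  obtain \<kappa> where \<kappa>: "\<kappa> \<ge> 0" "card B \<ge> 2 \<Longrightarrow> \<kappa> > 0"
    "\<And>u w. 0 \<le> u \<Longrightarrow> u \<le> w \<Longrightarrow> w \<le> 1 \<Longrightarrow>
       poly (block_poly (card N) B) w + \<kappa> * (w - u) \<le> poly (block_poly (card N) B) u"
    using block_poly_decreasing[OF fB pos k] by metis
  have "\<kappa> \<le> poly (drift_quotient B) u" by (rule reflection_quotient_ge[OF \<kappa>(3) u])
  then show "poly (drift_quotient B) u \<ge> 0" "card B \<ge> 2 \<Longrightarrow> poly (drift_quotient B) u > 0"
    using \<kappa>(1,2) by auto
qed

definition partition_prob :: "real \<Rightarrow> site set set \<Rightarrow> real" where
  "partition_prob t B = dual_semigroup t (\<lambda>z. if blocks z = B then 1 else 0) id"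

lemma partition_prob_bounds:
  assumes "t \<ge> 0"
  shows "partition_prob t B \<in> {0..1}"
  using dual_semigroup_mono[of t "\<lambda>_. 0" "\<lambda>z. if blocks z = B then 1 else 0" 1 id]
    dual_semigroup_mono[of t "\<lambda>z. if blocks z = B then 1 else 0" "\<lambda>_. 1" 1 id] assms
  by (simp add: partition_prob_def dual_semigroup_const)

lemma blocks_in: "blocks z \<in> Pow (Pow N - {{}})"
  by (auto simp: blocks_def)

lemma dual_semigroup_blocks:
  "dual_semigroup t (\<lambda>z. c (blocks z)) id = (\<Sum>B\<in>Pow (Pow N - {{}}). c B * partition_prob t B)"
proof -
  have "(\<lambda>z. c (blocks z)) = (\<lambda>z. \<Sum>B\<in>Pow (Pow N - {{}}). c B * (if blocks z = B then 1 else 0))"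
  proof
    fix z
    have "(\<Sum>B\<in>Pow (Pow N - {{}}). c B * (if blocks z = B then 1 else 0))
        = (\<Sum>B\<in>Pow (Pow N - {{}}). if blocks z = B then c B else 0)" by (intro sum.cong) auto
    also have "\<dots> = c (blocks z)"
      using blocks_in[of z] finite_N by (subst sum.delta') auto
    finally show "c (blocks z) = (\<Sum>B\<in>Pow (Pow N - {{}}). c B * (if blocks z = B then 1 else 0))" by simp
  qed
  then show ?thesis
    unfolding partition_prob_def by (simp only:) (rule dual_semigroup_sum[where C=1], simp)
qed

text \<open>
  The probabilities of having at least two blocks are bounded below by \<open>survival\<close>, and there are only finitely
  many families of blocks; so one of these families keeps a positive probability in the limit.
\<close>

lemma limiting_partition:
  obtains \<sigma> :: "nat \<Rightarrow> nat" and p where "strict_mono \<sigma>"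
    "\<And>B. B \<in> Pow (Pow N - {{}}) \<Longrightarrow> (\<lambda>n. partition_prob (real (\<sigma> n)) B) \<longlonglongrightarrow> p B"
    "\<And>B. B \<in> Pow (Pow N - {{}}) \<Longrightarrow> p B \<ge> 0"
    "\<exists>B \<in> Pow (Pow N - {{}}). card B \<ge> 2 \<and> p B > 0"
proof -
  let ?BB = "Pow (Pow N - {{}})"
  have fin: "finite ?BB" using finite_N by simp
  obtain \<sigma> p where \<sigma>: "strict_mono (\<sigma> :: nat \<Rightarrow> nat)"
    and p: "\<And>B. B \<in> ?BB \<Longrightarrow> (\<lambda>n. partition_prob (real (\<sigma> n)) B) \<longlonglongrightarrow> p B"
    using convergent_subsequence_finite_family[OF fin, of "\<lambda>n. partition_prob (real n)"] partition_prob_bounds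
    by (metis of_nat_0_le_iff)
  obtain h \<delta> M where h: "\<And>z. 0 \<le> h z" "\<And>z. h z \<le> (if card (blocks z) \<ge> 2 then 1 else 0)" "\<delta> > 0"
    "\<And>n. n \<ge> M \<Longrightarrow> \<delta> \<le> (dual_step ^^ n) h id"
    by (rule survival) blast
  have h1: "h z \<le> 1" for z using h(2)[of z] by (auto split: if_splits)
  let ?c = "\<lambda>B::site set set. if card B \<ge> 2 then 1 else 0 :: real"
  \<comment> \<open>The families with two or more blocks together have at least the mean of \<open>h\<close>.\<close>
  have lower: "\<delta> - \<delta> * (\<Sum>n<M. (clock_rate * t) ^ n / exp (clock_rate * t)) \<le> (\<Sum>B\<in>?BB. ?c B * partition_prob t B)"
    if "t \<ge> 0" for t
  proof -
    have "\<delta> - \<delta> * (\<Sum>n<M. (clock_rate * t) ^ n / exp (clock_rate * t)) \<le> dual_semigroup t h id"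
      by (rule dual_semigroup_ge[OF that h(1) h1 _ h(4)]) (use h(3) in auto)
    also have "\<dots> \<le> dual_semigroup t (\<lambda>z. ?c (blocks z)) id"
      by (rule dual_semigroup_mono[OF that h(2), where C=1]) (use h(1) h1 in \<open>auto simp: abs_of_nonneg\<close>)
    also have "\<dots> = (\<Sum>B\<in>?BB. ?c B * partition_prob t B)" by (rule dual_semigroup_blocks)
    finally show ?thesis .
  qed
  have \<sigma>_lim: "filterlim (\<lambda>n. real (\<sigma> n)) at_top sequentially"
    by (rule filterlim_compose[OF filterlim_real_sequentially filterlim_subseq[OF \<sigma>]])
  have "filterlim (\<lambda>n. clock_rate * real (\<sigma> n)) at_top sequentially"
    by (rule filterlim_tendsto_pos_mult_at_top[OF tendsto_const clock_rate_pos \<sigma>_lim])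
  then have "(\<lambda>n. (clock_rate * real (\<sigma> n)) ^ m / exp (clock_rate * real (\<sigma> n))) \<longlonglongrightarrow> 0" for m
    by (rule filterlim_compose[OF tendsto_power_div_exp_0])
  then have "(\<lambda>n. \<delta> - \<delta> * (\<Sum>m<M. (clock_rate * real (\<sigma> n)) ^ m / exp (clock_rate * real (\<sigma> n)))) \<longlonglongrightarrow> \<delta> - \<delta> * (\<Sum>m<M. 0)"
    by (intro tendsto_intros)
  moreover have "(\<lambda>n. \<Sum>B\<in>?BB. ?c B * partition_prob (real (\<sigma> n)) B) \<longlonglongrightarrow> (\<Sum>B\<in>?BB. ?c B * p B)"
    by (intro tendsto_intros p)
  ultimately have "\<delta> - \<delta> * (\<Sum>m<M. 0) \<le> (\<Sum>B\<in>?BB. ?c B * p B)"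
    by (rule LIMSEQ_le) (use lower in auto)
  then have "(\<Sum>B\<in>?BB. ?c B * p B) > 0" using h(3) by simp
  then obtain B where "B \<in> ?BB" "?c B * p B > 0"
    by (meson not_less sum_nonpos)
  then have "\<exists>B\<in>?BB. card B \<ge> 2 \<and> p B > 0" by (intro bexI[of _ B]) (auto split: if_splits)
  moreover have "p B \<ge> 0" if "B \<in> ?BB" for B
    using p[OF that] partition_prob_bounds by (intro LIMSEQ_le_const) auto
  ultimately show ?thesis using that \<sigma> p by blast
qed

text \<open>
  The weights \<open>p\<close> depend neither on \<open>u\<close> nor on the voter model process, so that the same polynomial serves all
  densities.
\<close>

lemma reaction_voter_equilibrium:
  assumes u: "u \<in> {0..1}" and \<nu>: "voter_equilibrium N u \<nu>"
    and \<sigma>: "strict_mono (\<sigma> :: nat \<Rightarrow> nat)"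
    "\<And>B. B \<in> Pow (Pow N - {{}}) \<Longrightarrow> (\<lambda>n. partition_prob (real (\<sigma> n)) B) \<longlonglongrightarrow> p B"
  shows "reaction coeff_q_less_1 N \<nu>
    = u * (1 - u) * (1 - 2 * u) * (\<Sum>B\<in>Pow (Pow N - {{}}). p B * poly (drift_quotient B) u)"
proof -
  let ?BB = "Pow (Pow N - {{}})" and ?w = "u * (1 - u) * (1 - 2 * u)"
  obtain P where P: "voter_model N P" and lim: "weakly_converges (\<lambda>t. product_measure u \<bind> P t) \<nu> at_top"
    using \<nu> unfolding voter_equilibrium_def by blast
  have "continuous_on UNIV observable"
    by (rule continuous_local[OF P _ observable_depends]) (simp add: finite_N)
  moreover have "bounded (range observable)"
    unfolding bounded_iff using observable_bounded by (auto simp: real_norm_def)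
  ultimately have "((\<lambda>t. \<integral>\<eta>. observable \<eta> \<partial>law_at (product_measure u) P t) \<longlongrightarrow> (\<integral>\<eta>. observable \<eta> \<partial>\<nu>)) at_top"
    using lim unfolding weakly_converges_def law_at_def by blast
  moreover have "filterlim (\<lambda>n. real (\<sigma> n)) at_top sequentially"
    by (rule filterlim_compose[OF filterlim_real_sequentially filterlim_subseq[OF \<sigma>(1)]])
  ultimately have "(\<lambda>n. \<integral>\<eta>. observable \<eta> \<partial>law_at (product_measure u) P (real (\<sigma> n))) \<longlonglongrightarrow> (\<integral>\<eta>. observable \<eta> \<partial>\<nu>)"
    by (rule filterlim_compose)
  moreover have "(\<integral>\<eta>. observable \<eta> \<partial>law_at (product_measure u) P t)
      = (\<Sum>B\<in>?BB. ?w * poly (drift_quotient B) u * partition_prob t B)" if "t \<ge> 0" for t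
  proof -
    have "(\<integral>\<eta>. observable \<eta> \<partial>law_at (product_measure u) P t)
      = dual_semigroup t (\<lambda>z. ?w * poly (drift_quotient (blocks z)) u) id"
      using voter_duality[OF P product_measure_prob[of u] observable_depends observable_bounded that, of id]
      by (simp add: integral_observable[OF u])
    also have "\<dots> = (\<Sum>B\<in>?BB. ?w * poly (drift_quotient B) u * partition_prob t B)"
      by (rule dual_semigroup_blocks)
    finally show ?thesis .
  qed
  ultimately have "(\<lambda>n. \<Sum>B\<in>?BB. ?w * poly (drift_quotient B) u * partition_prob (real (\<sigma> n)) B) \<longlonglongrightarrow> (\<integral>\<eta>. observable \<eta> \<partial>\<nu>)"
    by simp
  moreover have "(\<lambda>n. \<Sum>B\<in>?BB. ?w * poly (drift_quotient B) u * partition_prob (real (\<sigma> n)) B)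
      \<longlonglongrightarrow> (\<Sum>B\<in>?BB. ?w * poly (drift_quotient B) u * p B)"
    by (intro tendsto_intros \<sigma>(2))
  ultimately have "(\<integral>\<eta>. observable \<eta> \<partial>\<nu>) = (\<Sum>B\<in>?BB. ?w * poly (drift_quotient B) u * p B)"
    by (rule LIMSEQ_unique)
  moreover have "reaction coeff_q_less_1 N \<nu> = (\<integral>\<eta>. observable \<eta> \<partial>\<nu>)"
    using \<nu> unfolding voter_equilibrium_def by (intro reaction_eq_integral[OF P]) auto
  ultimately show ?thesis by (simp add: sum_distrib_left mult_ac)
qed

end

theorem theorem2:
  fixes N :: "site set" and k :: nat
  assumes "finite N" and "0 \<notin> N" and "card N = k" and "k \<ge> 3"
    and "group_closure N = UNIV"
  shows "\<exists>(c::real) (f::real poly).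
    c > 0 \<and> (\<forall>u\<in>{0..1}. poly f u > 0) \<and> poly f 0 = 1 \<and> poly f 1 = 1 \<and>
    (\<forall>u\<in>{0..1}. \<forall>\<nu>. voter_equilibrium N u \<nu> \<longrightarrow>
       reaction coeff_q_less_1 N \<nu> = c * u * (1 - u) * (1 - 2 * u) * poly f u \<and>
       reaction coeff_q_greater_1 N \<nu> = - c * u * (1 - u) * (1 - 2 * u) * poly f u)"
proof -
  interpret neighborhood N using assms by unfold_locales auto
  let ?BB = "Pow (Pow N - {{}})"
  obtain \<sigma> :: "nat \<Rightarrow> nat" and p where \<sigma>: "strict_mono \<sigma>"
    "\<And>B. B \<in> ?BB \<Longrightarrow> (\<lambda>n. partition_prob (real (\<sigma> n)) B) \<longlonglongrightarrow> p B"
    and p: "\<And>B. B \<in> ?BB \<Longrightarrow> p B \<ge> 0" "\<exists>B\<in>?BB. card B \<ge> 2 \<and> p B > 0"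
    by (rule limiting_partition) blast
  define G where "G = (\<Sum>B\<in>?BB. smult (p B) (drift_quotient B))"
  have G: "poly G u = (\<Sum>B\<in>?BB. p B * poly (drift_quotient B) u)" for u
    by (simp add: G_def poly_sum)
  have pos: "poly G u > 0" if u: "u \<in> {0..1}" for u
  proof -
    obtain B where B: "B \<in> ?BB" "card B \<ge> 2" "p B > 0" using p(2) by blast
    show ?thesis
      unfolding G
    proof (rule sum_pos2[OF _ B(1)])
      show "0 < p B * poly (drift_quotient B) u"
        using B drift_quotient_nonneg(2)[OF _ u, of B] by simp
      show "0 \<le> p B * poly (drift_quotient B) u" if "B \<in> ?BB" for B
        using p(1)[OF that] drift_quotient_nonneg(1)[OF _ u, of B] that by simp
    qed (simp add: finite_N)
  qed
  have ends: "poly G 1 = poly G 0" by (simp add: G reflection_quotient_endpoints)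
  define c where "c = poly G 0"
  define f where "f = smult (1 / c) G"
  have c: "c > 0" unfolding c_def by (rule pos) simp
  have "reaction coeff_q_less_1 N \<nu> = c * u * (1 - u) * (1 - 2 * u) * poly f u"
    if "u \<in> {0..1}" "voter_equilibrium N u \<nu>" for u \<nu>
    using reaction_voter_equilibrium[OF that \<sigma>] c by (simp add: G[symmetric] f_def)
  moreover have "reaction coeff_q_greater_1 N \<nu> = - reaction coeff_q_less_1 N \<nu>" for \<nu>
    by (simp add: reaction_def coeff_q_greater_1_def coeff_q_less_1_def sum_negf)
  moreover have "poly f u > 0" if "u \<in> {0..1}" for u using pos[OF that] c by (simp add: f_def)
  moreover have "poly f 0 = 1" "poly f 1 = 1" using c by (simp_all add: f_def ends c_def)
  ultimately show ?thesis using c by (intro exI[of _ c] exI[of _ f]) auto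
qed

end
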